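(* Let $\alpha<\omega_1$ be an ordinal, let $X$ be an Asplund space, and assume that the metric space $M_{\omega^\alpha}$ (constructed in the context, for the ordinal $\omega^\alpha$) embeds into $X$ with distortion strictly less than $2$. Then $\operatorname{Sz}(X)\ge\omega^{\alpha+1}$, where $\operatorname{Sz}(X)$ is the Szlenk index of $X$.
   Context: Embeddings. A mapping $f:M\to N$ between metric spaces $(M,d)$ and $(N,\rho)$ is a Lipschitz embedding if there are $C_1,C_2>0$ with $C_1d(x,y)\le\rho(f(x),f(y))\le C_2d(x,y)$ for all $x,y\in M$; $\operatorname{dist}(f)$ is the infimum of $C_2/C_1$ over such constants. $M$ embeds into $N$ with distortion strictly less than $2$ if there is a Lipschitz embedding $f:M\to N$ with $\operatorname{dist}(f)<2$. Szlenk index. For $\varepsilon>0$ and a weak$^*$-compact $F\subset X^*$, let $s_\varepsilon(F)$ be $F$ minus the union of all weak$^*$-open sets $V$ with $\operatorname{diam}(V\cap F)<\varepsilon$. Iterate transfinitely from $F=B_{X^*}$ (intersections at limit steps); $\operatorname{Sz}(X,\varepsilon)$ is the least ordinal at which the iterate is empty, and $\operatorname{Sz}(X)=\sup_{\varepsilon>0}\operatorname{Sz}(X,\varepsilon)$ (it is $\infty$ if some $\operatorname{Sz}(X,\varepsilon)$ does not exist, and $\infty$ is larger than every ordinal). Conventions. $\mathbb N=\{1,2,\dots\}$; $\frown$ is concatenation of finite sequences. 3-level graphs. For pairwise disjoint sets $C_1,\dots,C_h$ let $F(C_1,\dots,C_h)=\{\{c_1,\dots,c_h\}:c_i\in C_i\}$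 and let $M(C_1,\dots,C_h)=\{\mathbf 0\}\cup\bigcup_{i=1}^hC_i\cup F(C_1,\dots,C_h)$ (disjoint union), a graph with an edge between $\mathbf 0$ and each $c\in\bigcup C_i$, an edge between $c\in\bigcup C_i$ and $S\in F(C_1,\dots,C_h)$ iff $c\in S$, and no other edges; it is equipped with the shortest path metric. Sup-amalgam. Let $((M_i,d_i))_{i\in I}$ be metric spaces of uniformly bounded diameter with a common subset $A\subset M_i$ and a distinguished point $\mathbf 0\in A$. The sup-amalgam $(M_i)_{i\in I}/A$ is the set of those $x\in\prod_{i\in I}M_i$ such that either $x(i)=x(j)\in A$ for all $i,j\in I$, or there is exactly one $i\in I$ with $x(i)\notin A$ and $x(j)=\mathbf 0$ for all $j\ne i$; its metric is $d(x,y)=\sup_id_i(x(i),y(i))$. In all uses below the metrics $d_i$ agree on $A$, distinct points of $M_i$ are at distance at least $1$, and $d_i(a,\mathbf 0)\le1$ for $a\in A$; then $A$ (via constant families) and each $M_i$ have canonical isometric copies in the amalgam, which are identified with $A$ and $M_i$. Trees. Define trees of nonempty finite sequences in $\mathbb N$, for every $\alpha<\omega_1$: $T_1=\mathbb N$ (sequences of length one); $T_{\alpha+1}=\mathbb N\cup\bigcup_{n=1}^\infty n\frown T_\alpha$ if $\alpha$ is a successor; $T_{\alpha+1}=\mathbb N\cup\bigcup_{n=1}^\infty n\frown T_{\alpha_n+1}$ if $\alpha$ is a limit, where $\alpha_n\nearrow\alpha$ is a fixed chosen strictly increasing sequence. Here $n\frown T=\{n\frown\overline m:\overline m\in T\}$.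 For a tree $T$, $\max T$ is the set of nodes with no proper extension in $T$, and $T'=\{(n_1,\dots,n_h)\in T:(n_1,\dots,n_{h-1},k)\in T \text{ is not maximal in }T\text{ for some }k\in\mathbb N\}$. Put $T^{(0)}=T$, $T^{(\beta+1)}=(T^{(\beta)})'$, $T^{(\beta)}=\bigcap_{\gamma<\beta}T^{(\gamma)}$ for limit $\beta$. The spaces $M^{\mu+1}_\emptyset$. Fix pairwise disjoint countably infinite sets $A_i=\{a^i_1,a^i_2,\dots\}$, $i\ge0$, put $A_i^k=\{a_1^i,\dots,a^i_k\}$, and assume $A_0^2=\{1,2\}$. Fix $\mu<\omega_1$ and let $T=T_{\mu+1}$. For $\overline n=(n_1,\dots,n_h)\in\max T$ put $M^0_{\overline n}=M(A_0^2,A_1^{n_1},\dots,A_h^{n_h})$. For $\overline n=(n_1,\dots,n_h)\in\max T^{(\beta+1)}$ put $M^{\beta+1}_{\overline n}=M^\beta_{\overline n}$ if $\overline n\in\max T^{(\beta)}$, and otherwise $M^{\beta+1}_{\overline n}=(M^\beta_{\overline n\frown k})_{k=1}^\infty/(\{\mathbf 0\}\cup A_0^2\cup A_1^{n_1}\cup\dots\cup A_h^{n_h})$. For limit $\beta\le\mu$ and $\overline n\in\max T^{(\beta)}$, $M^\beta_{\overline n}$ is the eventually constant value of $M^\gamma_{\overline n}$ as $\gamma\to\beta$, $\gamma<\beta$. (One has $T^{(\mu)}=\mathbb N$.) Finally $M^{\mu+1}_\emptyset=(M^\mu_n)_{n=1}^\infty/(\{\mathbf 0\}\cup A_0^2)$.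 The spaces $M_\alpha$. If $\alpha=\mu+1$ is a successor, $M_\alpha:=M^{\mu+1}_\emptyset$. If $\alpha<\omega_1$ is a limit, choose $\mu_n\nearrow\alpha$ (strictly increasing) and put $M_\alpha:=(M^{\mu_n+1}_\emptyset)_{n=1}^\infty/(\{\mathbf 0\}\cup A_0^2)$. The statement concerns $M_{\omega^\alpha}$ (where $\omega^0=1$), for any fixed choices of the sequences involved. *)

theory Defs
  imports "HOL-Analysis.Analysis" "HOL-Library.Extended"
begin

unbundle cardinal_syntax

section \<open>Ordinals\<close>

text \<open>
  The type \<open>'u ordinal\<close> is the initial ordinal \<open>\<kappa>\<^sup>+\<close>, where \<open>\<kappa>\<close> is the cardinality of \<open>nat + 'u\<close>;
  its elements are thus all ordinals of cardinality at most \<open>\<kappa>\<close>.  In particular it contains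
  every countable ordinal, and \<open>\<alpha> < \<omega>\<^sub>1\<close> means that \<open>\<alpha>\<close> has countably many predecessors.
\<close>

typedef 'u ordinal = "Field (cardSuc |UNIV :: (nat + 'u) set| )"
proof -
  have "\<not> finite (Field (cardSuc |UNIV :: (nat + 'u) set| ))"
    by (simp add: card_of_cardSuc_finite)
  then show ?thesis by (metis ex_in_conv finite.emptyI)
qed

lemma cardSuc_univ_Well_order: "Well_order (cardSuc |UNIV :: (nat + 'u) set| )"
  using cardSuc_Card_order card_of_Card_order card_order_on_well_order_on by blast

instantiation ordinal :: (type) linorder
begin

definition less_eq_ordinal :: "'a ordinal \<Rightarrow> 'a ordinal \<Rightarrow> bool" where
  "x \<le> y \<longleftrightarrow> (Rep_ordinal x, Rep_ordinal y) \<in> cardSuc |UNIV :: (nat + 'a) set|"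

definition less_ordinal :: "'a ordinal \<Rightarrow> 'a ordinal \<Rightarrow> bool" where
  "(x :: 'a ordinal) < y \<longleftrightarrow> x \<le> y \<and> \<not> y \<le> x"

instance
proof
  fix x y z :: "'a ordinal"
  let ?r = "cardSuc |UNIV :: (nat + 'a) set|"
  have lin: "refl_on (Field ?r) ?r" "trans ?r" "antisym ?r" "total_on (Field ?r) ?r"
    using cardSuc_univ_Well_order[where 'u='a] by (auto simp: order_on_defs)
  show "(x < y) = (x \<le> y \<and> \<not> y \<le> x)" by (rule less_ordinal_def)
  show "x \<le> x" using lin(1) Rep_ordinal unfolding less_eq_ordinal_def by (meson refl_onD)
  show "x \<le> y \<Longrightarrow> y \<le> z \<Longrightarrow> x \<le> z"
    using lin(2) unfolding less_eq_ordinal_def by (meson transD)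
  show "x \<le> y \<Longrightarrow> y \<le> x \<Longrightarrow> x = y"
    using lin(3) unfolding less_eq_ordinal_def by (meson Rep_ordinal_inject antisymD)
  show "x \<le> y \<or> y \<le> x"
    using lin(4) lin(1) Rep_ordinal[of x] Rep_ordinal[of y] unfolding less_eq_ordinal_def
    by (metis refl_onD total_on_def)
qed

end

instance ordinal :: (type) wellorder
proof
  fix P :: "'u ordinal \<Rightarrow> bool" and a
  assume step: "\<And>x. (\<And>y. y < x \<Longrightarrow> P y) \<Longrightarrow> P x"
  let ?r = "cardSuc |UNIV :: (nat + 'u) set|"
  have wf: "wf (inv_image (?r - Id) (Rep_ordinal :: 'u ordinal \<Rightarrow> _))"
    using cardSuc_univ_Well_order[where 'u='u] by (auto simp: well_order_on_def)
  have "y < x \<Longrightarrow> (y, x) \<in> inv_image (?r - Id) Rep_ordinal" for x y :: "'u ordinal"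
    by (auto simp: inv_image_def less_eq_ordinal_def less_le Rep_ordinal_inject)
  moreover have "(y, x) \<in> inv_image (?r - Id) Rep_ordinal \<Longrightarrow> y < x" for x y :: "'u ordinal"
    by (auto simp: inv_image_def less_eq_ordinal_def less_le Rep_ordinal_inject)
  ultimately show "P a" using wf_induct_rule[OF wf, of P a] step by blast
qed

text \<open>Every set of at most \<open>\<kappa>\<close> ordinals is strictly bounded, so the least upper bounds used
  below exist.\<close>

lemma ordinal_bounded:
  fixes A :: "'u ordinal set"
  assumes "|A| \<le>o |UNIV :: (nat + 'u) set|"
  shows "\<exists>b. \<forall>a\<in>A. a < b"
proof (rule ccontr)
  assume "\<nexists>b. \<forall>a\<in>A. a < b"
  then have *: "\<exists>a\<in>A. b \<le> a" for b by (meson not_le)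
  let ?c = "|UNIV :: (nat + 'u) set|"
  let ?r = "cardSuc ?c"
  have inf: "\<not> finite (Field ?c)" by (simp add: Field_card_of)
  have r: "Card_order ?c" by (rule card_of_Card_order)
  have reg: "regularCard ?r" "Card_order ?r"
    using infinite_cardSuc_regularCard[OF inf r] cardSuc_Card_order[OF r] by auto
  have r_inf: "\<not> finite (Field ?r)" by (simp add: card_of_cardSuc_finite)
  have "cofinal (Rep_ordinal ` A) ?r"
    unfolding cofinal_def
  proof
    fix i assume i: "i \<in> Field ?r"
    then obtain j where j: "j \<in> Field ?r" "i \<noteq> j" "(i, j) \<in> ?r"
      using infinite_Card_order_limit[OF reg(2) r_inf] by blast
    obtain x where x: "j = Rep_ordinal x" using j(1) Rep_ordinal_cases by metis
    obtain a where a: "a \<in> A" "x \<le> a" using * by blast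
    have ja: "(j, Rep_ordinal a) \<in> ?r" using a(2) x by (simp add: less_eq_ordinal_def)
    have tr: "trans ?r" "antisym ?r"
      using cardSuc_univ_Well_order[where 'u='u] by (auto simp: order_on_defs)
    have "(i, Rep_ordinal a) \<in> ?r" using tr(1) j(3) ja by (meson transD)
    moreover have "i \<noteq> Rep_ordinal a" using tr(2) j ja by (metis antisymD)
    ultimately show "\<exists>b\<in>Rep_ordinal ` A. i \<noteq> b \<and> (i, b) \<in> ?r" using a(1) by blast
  qed
  moreover have "Rep_ordinal ` A \<subseteq> Field ?r" using Rep_ordinal by blast
  ultimately have "|Rep_ordinal ` A| =o ?r" using reg(1) unfolding regularCard_def by blast
  moreover have "|Rep_ordinal ` A| \<le>o ?c"
    using assms card_of_image ordLeq_transitive by blast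
  ultimately have "?r \<le>o ?c" using ordIso_ordLeq_trans ordIso_symmetric by blast
  then show False using cardSuc_greater[OF r] not_ordLess_ordLeq by blast
qed

instance ordinal :: (type) no_top
proof
  fix x :: "'u ordinal"
  have "|{x}| \<le>o |UNIV :: (nat + 'u) set|"
    by (simp add: card_of_singl_ordLeq)
  then show "\<exists>y. x < y" using ordinal_bounded[of "{x}"] by blast
qed

lemma ordinal_bounded_countable:
  fixes A :: "'u ordinal set"
  assumes "countable A"
  shows "\<exists>b. \<forall>a\<in>A. a < b"
proof -
  have "|A| \<le>o |UNIV :: nat set|"
    using assms unfolding countable_def by (meson card_of_ordLeq subset_UNIV)
  also have "|UNIV :: nat set| \<le>o |UNIV :: (nat + 'u) set|"
    using card_of_ordLeq[of "UNIV :: nat set" "UNIV :: (nat + 'u) set"] by (meson inj_Inl subset_UNIV)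
  finally show ?thesis by (rule ordinal_bounded)
qed

definition ozero :: "'o::wellorder" where
  "ozero = (LEAST x. True)"

definition osuc :: "'o::wellorder \<Rightarrow> 'o" where
  "osuc x = (LEAST y. x < y)"

definition is_osuc :: "'o::wellorder \<Rightarrow> bool" where
  "is_osuc x \<longleftrightarrow> (\<exists>y. x = osuc y)"

definition opred :: "'o::wellorder \<Rightarrow> 'o" where
  "opred x = (THE y. x = osuc y)"

definition is_limit :: "'o::wellorder \<Rightarrow> bool" where
  "is_limit x \<longleftrightarrow> x \<noteq> ozero \<and> \<not> is_osuc x"

definition osup :: "'o::wellorder set \<Rightarrow> 'o" where
  "osup A = (LEAST b. \<forall>a\<in>A. a \<le> b)"

definition countable_ordinal :: "'o::wellorder \<Rightarrow> bool" where
  "countable_ordinal x \<longleftrightarrow> countable {..<x}"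

text \<open>Transfinite recursion with separate zero, successor and limit clauses; the limit clause
  may consult the values at all smaller ordinals.\<close>

definition trec :: "'b \<Rightarrow> ('o \<Rightarrow> 'b \<Rightarrow> 'b) \<Rightarrow> ('o \<Rightarrow> ('o \<Rightarrow> 'b) \<Rightarrow> 'b) \<Rightarrow> 'o::wellorder \<Rightarrow> 'b" where
  "trec z s l = wfrec {(x, y). x < y}
     (\<lambda>f x. if x = ozero then z else if is_osuc x then s (opred x) (f (opred x)) else l x f)"

lemma osuc_greater: "x < osuc (x :: 'o :: {wellorder, no_top})"
  unfolding osuc_def using gt_ex by (rule LeastI_ex)

lemma osuc_le_iff: "osuc x \<le> y \<longleftrightarrow> x < (y :: 'o :: {wellorder, no_top})"
  using osuc_greater[of x] unfolding osuc_def by (meson Least_le dual_order.strict_trans1 not_le)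

lemma osuc_inject: "osuc x = osuc y \<longleftrightarrow> x = (y :: 'o :: {wellorder, no_top})"
  by (metis osuc_greater osuc_le_iff neq_iff not_le order_refl)

lemma opred_osuc: "opred (osuc x) = (x :: 'o :: {wellorder, no_top})"
  unfolding opred_def by (rule the_equality) (auto simp: osuc_inject)

lemma ozero_le: "ozero \<le> (x :: 'o :: wellorder)"
  unfolding ozero_def by (rule Least_le) simp

lemma osuc_neq_ozero: "osuc x \<noteq> (ozero :: 'o :: {wellorder, no_top})"
  using osuc_greater[of x] ozero_le[of x] by auto

lemma trec_unfold:
  "trec z s l x = (if x = ozero then z
     else if is_osuc x then s (opred x) (cut (trec z s l) {(x, y). x < y} x (opred x))
     else l x (cut (trec z s l) {(x, y). x < y} x))" for x :: "'o :: wellorder"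
  by (subst (1) trec_def, subst wfrec[OF wf], fold trec_def) (rule refl)

lemma trec_ozero: "trec z s l (ozero :: 'o :: wellorder) = z"
  by (simp add: trec_unfold)

lemma trec_osuc: "trec z s l (osuc x) = s x (trec z s l x)" for x :: "'o :: {wellorder, no_top}"
  by (subst trec_unfold)
     (auto simp: osuc_neq_ozero opred_osuc is_osuc_def cut_apply osuc_greater)

lemma trec_limit:
  fixes x :: "'o :: wellorder"
  assumes "is_limit x" and "\<And>f g. (\<And>y. y < x \<Longrightarrow> f y = g y) \<Longrightarrow> l x f = l x g"
  shows "trec z s l x = l x (trec z s l)"
  using assms(1) by (subst trec_unfold) (auto simp: is_limit_def cut_apply intro!: assms(2))

definition oadd :: "'o::wellorder \<Rightarrow> 'o \<Rightarrow> 'o" where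
  "oadd a = trec a (\<lambda>_ c. osuc c) (\<lambda>b f. osup (f ` {..<b}))"

definition omult :: "'o::wellorder \<Rightarrow> 'o \<Rightarrow> 'o" where
  "omult a = trec ozero (\<lambda>_ c. oadd c a) (\<lambda>b f. osup (f ` {..<b}))"

definition omega :: "'o::wellorder" where
  "omega = (LEAST x. is_limit x)"

definition omega_power :: "'o::wellorder \<Rightarrow> 'o" where
  "omega_power = trec (osuc ozero) (\<lambda>_ c. omult c omega) (\<lambda>b f. osup (f ` {..<b}))"

text \<open>Transfinite iteration of a derivation, with intersections at limit steps.\<close>

definition iterate :: "('a set \<Rightarrow> 'a set) \<Rightarrow> 'a set \<Rightarrow> 'o::wellorder \<Rightarrow> 'a set" where
  "iterate D F = trec F (\<lambda>_ G. D G) (\<lambda>b f. \<Inter>c\<in>{..<b}. f c)"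

text \<open>\<open>s 1, s 2, \<dots>\<close> increases strictly to \<open>b\<close> (sequences are indexed by the positive integers
  throughout, so \<open>s 0\<close> is irrelevant).\<close>

definition increases_to :: "(nat \<Rightarrow> 'o::wellorder) \<Rightarrow> 'o \<Rightarrow> bool" where
  "increases_to s b \<longleftrightarrow>
     strict_mono_on {1..} s \<and> (\<forall>n\<ge>1. s n < b) \<and> (\<forall>c<b. \<exists>n\<ge>1. c < s n)"

definition fundamental_sequences :: "('o::wellorder \<Rightarrow> nat \<Rightarrow> 'o) \<Rightarrow> bool" where
  "fundamental_sequences fs \<longleftrightarrow>
     (\<forall>b. is_limit b \<and> countable_ordinal b \<longrightarrow> increases_to (fs b) b)"


section \<open>Asplund spaces and the Szlenk index\<close>

text \<open>Every continuous convex function on an open convex set is Frechet differentiable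
  (\<open>differentiable\<close>) at all points of a dense \<open>G\<^sub>\<delta>\<close> subset.\<close>

definition asplund :: "'x::banach itself \<Rightarrow> bool" where
  "asplund _ \<longleftrightarrow>
     (\<forall>(U :: 'x set) f. open U \<and> convex U \<and> continuous_on U f \<and> convex_on U f \<longrightarrow>
        (\<exists>G. gdelta G \<and> G \<subseteq> U \<and> U \<subseteq> closure G \<and> (\<forall>x\<in>G. f differentiable (at x))))"

text \<open>On the dual space \<open>'x \<Rightarrow>\<^sub>L real\<close> the topology of pointwise convergence is the
  weak* topology.\<close>

abbreviation weak_star :: "('x::real_normed_vector \<Rightarrow>\<^sub>L real) topology" where
  "weak_star \<equiv> strong_operator_topology"

definition szlenk_deriv ::
    "real \<Rightarrow> ('x::real_normed_vector \<Rightarrow>\<^sub>L real) set \<Rightarrow> ('x \<Rightarrow>\<^sub>L real) set" where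
  "szlenk_deriv \<epsilon> F = F - \<Union>{V. openin weak_star V \<and> diameter (V \<inter> F) < \<epsilon>}"

definition szlenk_iter ::
    "real \<Rightarrow> ('x::real_normed_vector \<Rightarrow>\<^sub>L real) ordinal \<Rightarrow> ('x \<Rightarrow>\<^sub>L real) set" where
  "szlenk_iter \<epsilon> = iterate (szlenk_deriv \<epsilon>) (cball 0 1)"

text \<open>If some iterate is empty, then the first such iterate has an index of cardinality at most
  that of the dual: the earlier iterates decrease strictly.  So ordinals of type
  \<open>('x \<Rightarrow>\<^sub>L real) ordinal\<close> suffice for the index, and so do they for its supremum over \<open>\<epsilon>\<close>.\<close>

definition szlenk_eps ::
    "'x::banach itself \<Rightarrow> real \<Rightarrow> ('x \<Rightarrow>\<^sub>L real) ordinal extended" where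
  "szlenk_eps _ \<epsilon> =
     (if \<exists>b. szlenk_iter \<epsilon> b = ({} :: ('x \<Rightarrow>\<^sub>L real) set)
      then Fin (LEAST b. szlenk_iter \<epsilon> b = ({} :: ('x \<Rightarrow>\<^sub>L real) set)) else Pinf)"

definition szlenk_index :: "'x::banach itself \<Rightarrow> ('x \<Rightarrow>\<^sub>L real) ordinal extended" where
  "szlenk_index X = (LEAST s. \<forall>\<epsilon>>0. szlenk_eps X \<epsilon> \<le> s)"


section \<open>Lipschitz embeddings\<close>

text \<open>A metric space is given by its carrier and its distance function (whose values outside
  the carrier are irrelevant).\<close>

type_synonym 'a mspc = "'a set \<times> ('a \<Rightarrow> 'a \<Rightarrow> real)"

definition bilipschitz_with ::
    "'a mspc \<Rightarrow> ('a \<Rightarrow> 'b::metric_space) \<Rightarrow> real \<Rightarrow> real \<Rightarrow> bool" where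
  "bilipschitz_with M f C1 C2 \<longleftrightarrow> C1 > 0 \<and> C2 > 0 \<and>
     (\<forall>x\<in>fst M. \<forall>y\<in>fst M. C1 * snd M x y \<le> dist (f x) (f y) \<and> dist (f x) (f y) \<le> C2 * snd M x y)"

definition lipschitz_embedding :: "'a mspc \<Rightarrow> ('a \<Rightarrow> 'b::metric_space) \<Rightarrow> bool" where
  "lipschitz_embedding M f \<longleftrightarrow> (\<exists>C1 C2. bilipschitz_with M f C1 C2)"

definition distortion :: "'a mspc \<Rightarrow> ('a \<Rightarrow> 'b::metric_space) \<Rightarrow> real" where
  "distortion M f = Inf {C2 / C1 | C1 C2. bilipschitz_with M f C1 C2}"


section \<open>The metric spaces\<close>

text \<open>The element \<open>a\<^sup>i\<^sub>j\<close> of \<open>A\<^sub>i\<close> is represented by the pair \<open>(i, j)\<close>, where \<open>j \<ge> 1\<close>.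
  A point is the origin, a vertex \<open>a\<^sup>i\<^sub>j\<close>, a finite set of such vertices, or an element of
  a product of previously constructed spaces.\<close>

datatype point = Origin | Vertex "nat \<times> nat" | Face "(nat \<times> nat) set" | Family "nat \<Rightarrow> point"

definition faces :: "(nat \<times> nat) set list \<Rightarrow> (nat \<times> nat) set set" where
  "faces Cs = {set cs | cs. list_all2 (\<in>) cs Cs}"

definition graph_points :: "(nat \<times> nat) set list \<Rightarrow> point set" where
  "graph_points Cs = {Origin} \<union> Vertex ` \<Union>(set Cs) \<union> Face ` faces Cs"

definition graph_edges :: "(nat \<times> nat) set list \<Rightarrow> (point \<times> point) set" where
  "graph_edges Cs =
     (let E = {(Origin, Vertex c) | c. c \<in> \<Union>(set Cs)} \<union>
              {(Vertex c, Face S) | c S. c \<in> \<Union>(set Cs) \<and> S \<in> faces Cs \<and> c \<in> S}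
      in E \<union> E\<inverse>)"

definition level_graph :: "(nat \<times> nat) set list \<Rightarrow> point mspc" where
  "level_graph Cs = (graph_points Cs, \<lambda>x y. real (LEAST n. (x, y) \<in> graph_edges Cs ^^ n))"

text \<open>Sup-amalgam of \<open>M 1, M 2, \<dots>\<close> over the common subset \<open>A\<close> (which contains the origin).
  Constant families in \<open>A\<close> are identified with their value, so that \<open>A\<close> is literally a subset
  of the amalgam; \<open>A\<close> never contains a point of the form \<open>Family x\<close>.\<close>

definition amalgam_families :: "point set \<Rightarrow> (nat \<Rightarrow> point mspc) \<Rightarrow> (nat \<Rightarrow> point) set" where
  "amalgam_families A M = {x \<in> Pi\<^sub>E {1..} (\<lambda>i. fst (M i)).
     (\<forall>i\<ge>1. \<forall>j\<ge>1. x i = x j \<and> x i \<in> A) \<or>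
     (\<exists>!i. i \<ge> 1 \<and> x i \<notin> A \<and> (\<forall>j\<ge>1. j \<noteq> i \<longrightarrow> x j = Origin))}"

definition point_of_family :: "point set \<Rightarrow> (nat \<Rightarrow> point) \<Rightarrow> point" where
  "point_of_family A x = (if x 1 \<in> A \<and> (\<forall>i\<ge>1. x i = x 1) then x 1 else Family x)"

definition family_of_point :: "point set \<Rightarrow> point \<Rightarrow> nat \<Rightarrow> point" where
  "family_of_point A p =
     (if p \<in> A then (\<lambda>i\<in>{1..}. p) else (case p of Family x \<Rightarrow> x | _ \<Rightarrow> undefined))"

definition sup_amalgam :: "point set \<Rightarrow> (nat \<Rightarrow> point mspc) \<Rightarrow> point mspc" where
  "sup_amalgam A M =
     (point_of_family A ` amalgam_families A M,
      \<lambda>p q. SUP i\<in>{1..}. snd (M i) (family_of_point A p i) (family_of_point A q i))"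

text \<open>\<open>tree_suc fs \<alpha>\<close> is the tree \<open>T\<^bsub>\<alpha>+1\<^esub>\<close>, where \<open>fs\<close> chooses the sequences
  \<open>\<alpha>\<^sub>n \<nearrow> \<alpha>\<close> at limit ordinals.\<close>

definition tree_suc :: "('o::wellorder \<Rightarrow> nat \<Rightarrow> 'o) \<Rightarrow> 'o \<Rightarrow> nat list set" where
  "tree_suc fs = trec {[n] | n. n \<ge> 1}
     (\<lambda>_ T. {[n] | n. n \<ge> 1} \<union> (\<Union>n\<in>{1..}. (#) n ` T))
     (\<lambda>\<alpha> T. {[n] | n. n \<ge> 1} \<union> (\<Union>n\<in>{1..}. (#) n ` T (fs \<alpha> n)))"

definition max_nodes :: "nat list set \<Rightarrow> nat list set" where
  "max_nodes T = {m \<in> T. \<not> (\<exists>r. r \<noteq> [] \<and> m @ r \<in> T)}"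

definition tree_deriv :: "nat list set \<Rightarrow> nat list set" where
  "tree_deriv T = {m \<in> T. \<exists>k\<ge>1. butlast m @ [k] \<in> T \<and> butlast m @ [k] \<notin> max_nodes T}"

definition segment :: "nat \<Rightarrow> nat \<Rightarrow> (nat \<times> nat) set" where
  "segment i k = {(i, j) | j. 1 \<le> j \<and> j \<le> k}"

text \<open>For \<open>n = (n\<^sub>1, \<dots>, n\<^sub>h)\<close> this is the list \<open>A\<^sub>0\<^sup>2, A\<^sub>1\<close> up to \<open>n\<^sub>1, \<dots>, A\<^sub>h\<close> up to \<open>n\<^sub>h\<close>.\<close>

definition levels :: "nat list \<Rightarrow> (nat \<times> nat) set list" where
  "levels n = segment 0 2 # map (\<lambda>i. segment (Suc i) (n ! i)) [0..<length n]"

definition common_part :: "nat list \<Rightarrow> point set" where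
  "common_part n = {Origin} \<union> Vertex ` \<Union>(set (levels n))"

text \<open>\<open>stage T \<beta> n\<close> is \<open>M\<^sup>\<beta>\<^sub>n\<close>; it is meaningful for maximal nodes \<open>n\<close> of the
  \<open>\<beta>\<close>-th derived tree only.\<close>

definition stage :: "nat list set \<Rightarrow> 'o::wellorder \<Rightarrow> nat list \<Rightarrow> point mspc" where
  "stage T = trec (\<lambda>n. level_graph (levels n))
     (\<lambda>\<beta> M n. if n \<in> max_nodes (iterate tree_deriv T \<beta>) then M n
               else sup_amalgam (common_part n) (\<lambda>k. M (n @ [k])))
     (\<lambda>\<beta> M n. THE N. \<exists>\<gamma><\<beta>. \<forall>\<delta>. \<gamma> \<le> \<delta> \<and> \<delta> < \<beta> \<longrightarrow> M \<delta> n = N)"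

text \<open>\<open>M_suc fs \<mu>\<close> is the space with superscript \<open>\<mu> + 1\<close> at the empty sequence.\<close>

definition M_suc :: "('o::wellorder \<Rightarrow> nat \<Rightarrow> 'o) \<Rightarrow> 'o \<Rightarrow> point mspc" where
  "M_suc fs \<mu> = sup_amalgam (common_part []) (\<lambda>n. stage (tree_suc fs \<mu>) \<mu> [n])"

text \<open>The space \<open>M\<^sub>\<alpha>\<close> for \<open>\<alpha> > 0\<close>; the sequences chosen at limits for the trees (\<open>fs\<close>) and for
  the final amalgam (\<open>ms\<close>) are independent of each other.\<close>

definition M_space ::
    "('o::wellorder \<Rightarrow> nat \<Rightarrow> 'o) \<Rightarrow> ('o \<Rightarrow> nat \<Rightarrow> 'o) \<Rightarrow> 'o \<Rightarrow> point mspc" where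
  "M_space fs ms \<alpha> = (if is_osuc \<alpha> then M_suc fs (opred \<alpha>)
     else sup_amalgam (common_part []) (\<lambda>n. M_suc fs (ms \<alpha> n)))"

end

theory Submission
  imports Defs
begin

text \<open>
  Let \<open>C1 d \<le> dist \<le> C2 d\<close> along \<open>f\<close> with \<open>C2 < 2 C1\<close>, and put \<open>\<eta> = 4 C1 - 2 C2 > 0\<close>.
  Two disjoint faces \<open>S, S'\<close> are at distance 4 and each is at distance 1 from its vertices, so a
  functional norming \<open>f S - f S'\<close> separates \<open>f a\<close> from \<open>f b\<close> by \<open>\<eta>\<close> for all \<open>a \<in> S\<close>,
  \<open>b \<in> S'\<close>.  Going down the tree towards the root, such separating functionals are found in
  higher and higher Szlenk derivatives of the dual ball, for \<open>\<epsilon> = \<eta> / (4 C2)\<close>.  At a node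
  \<open>p\<close>, the child \<open>p\<frown>k\<close> provides functionals \<open>\<phi>\<^sub>i\<^sub>j\<close> (\<open>i \<noteq> j \<le> k\<close>) that separate the extensions of
  \<open>S\<close> and \<open>S'\<close> by the \<open>i\<close>-th and \<open>j\<close>-th new vertex.  Finitely many sets of diameter less than
  \<open>\<epsilon>\<close> cannot cover all of these when \<open>k\<close> is large: by the pigeonhole principle two new vertices
  have almost the same values under one chosen functional from each of the sets, whereas \<open>\<phi>\<^sub>i\<^sub>j\<close>
  tells them apart by \<open>\<eta>\<close>.  By weak* compactness one derivative is gained at each successor
  step, and nothing is lost at limit steps.  Hence the derivative of order \<open>\<omega>\<^sup>\<alpha>\<close> is nonempty,
  and convexity of the ball yields nonempty derivatives of all orders \<open>\<omega>\<^sup>\<alpha> n\<close> for smaller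
  values of \<open>\<epsilon>\<close>.
\<close>

section \<open>Ordinals\<close>

lemma ordinal_cases [case_names zero suc limit]:
  fixes x :: "'o::{wellorder,no_top}"
  obtains "x = ozero" | y where "x = osuc y" | "is_limit x"
  unfolding is_limit_def is_osuc_def by blast

lemma ordinal_induct [case_names zero suc limit]:
  fixes x :: "'o::{wellorder,no_top}"
  assumes "P ozero" "\<And>y. P y \<Longrightarrow> P (osuc y)"
    "\<And>x. is_limit x \<Longrightarrow> (\<And>y. y < x \<Longrightarrow> P y) \<Longrightarrow> P x"
  shows "P x"
proof (induction x rule: less_induct)
  case (less x)
  then show ?case by (cases x rule: ordinal_cases) (use assms osuc_greater in auto)
qed

lemma less_osuc_iff: "x < osuc y \<longleftrightarrow> x \<le> (y :: 'o::{wellorder,no_top})"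
  by (metis osuc_le_iff not_le)

lemma limit_osuc_less: "is_limit x \<Longrightarrow> y < x \<Longrightarrow> osuc y < (x :: 'o::{wellorder,no_top})"
  unfolding is_limit_def is_osuc_def by (metis osuc_le_iff le_less)

lemma ozero_less_limit: "is_limit x \<Longrightarrow> ozero < (x :: 'o::{wellorder,no_top})"
  unfolding is_limit_def using ozero_le[of x] by auto

lemma countable_ordinal_mono: "countable_ordinal x \<Longrightarrow> y \<le> x \<Longrightarrow> countable_ordinal y"
  unfolding countable_ordinal_def by (rule countable_subset) auto

lemma countable_ordinal_osucD:
  "countable_ordinal (osuc x) \<Longrightarrow> countable_ordinal (x :: 'o::{wellorder,no_top})"
  using countable_ordinal_mono[of "osuc x" x] osuc_greater[of x] by simp

lemma countable_ordinal_osuc: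
  "countable_ordinal x \<Longrightarrow> countable_ordinal (osuc x :: 'o::{wellorder,no_top})"
proof -
  assume "countable_ordinal x"
  moreover have "{..<osuc x} = insert x {..<x}" using less_osuc_iff by (auto simp: le_less)
  ultimately show ?thesis unfolding countable_ordinal_def by simp
qed

lemma countable_ordinal_ozero: "countable_ordinal (ozero :: 'o::wellorder)"
proof -
  have "{..<ozero :: 'o} = {}" using ozero_le leD by blast
  then show ?thesis unfolding countable_ordinal_def by simp
qed

lemma osup_least: "(\<And>a. a \<in> A \<Longrightarrow> a \<le> b) \<Longrightarrow> osup A \<le> (b :: 'o::wellorder)"
  unfolding osup_def by (rule Least_le) blast

text \<open>\<open>osup\<close> is a \<open>LEAST\<close> and says nothing unless some upper bound
  exists. Countable sets of ordinals in this type are bounded, which is why countability accompanies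
  the ordinal arithmetic below.\<close>

lemma osup_upper:
  fixes A :: "'u ordinal set"
  assumes "countable A" "a \<in> A"
  shows "a \<le> osup A"
proof -
  have "\<exists>b. \<forall>a\<in>A. a \<le> b" using ordinal_bounded_countable[OF assms(1)] less_imp_le by blast
  then have "\<forall>a\<in>A. a \<le> osup A" unfolding osup_def by (rule LeastI_ex)
  then show ?thesis using assms(2) by blast
qed

lemma less_osup: "c < osup A \<Longrightarrow> \<exists>a\<in>A. c < (a :: 'o::wellorder)"
  using osup_least[of A c] by (meson not_le)

text \<open>Every ordinal below the supremum precedes a member, so the predecessors form a countable
  union of countable sets.\<close>

lemma countable_ordinal_osup:
  fixes A :: "'o::wellorder set"
  assumes "countable A" "\<And>a. a \<in> A \<Longrightarrow> countable_ordinal a"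
  shows "countable_ordinal (osup A)"
proof -
  have "{..<osup A} \<subseteq> (\<Union>a\<in>A. {..<a})" using less_osup by force
  moreover have "countable (\<Union>a\<in>A. {..<a})"
    using assms unfolding countable_ordinal_def by auto
  ultimately show ?thesis unfolding countable_ordinal_def by (rule countable_subset)
qed

text \<open>A limit clause that sees the earlier values only through their image meets the
  congruence condition of \<open>trec_limit\<close>. This covers sums, products, powers and iterated
  derivations at once.\<close>

lemma trec_limit_image:
  "is_limit x \<Longrightarrow> trec z s (\<lambda>b f. g (f ` {..<b})) x = g (trec z s (\<lambda>b f. g (f ` {..<b})) ` {..<x :: 'o::wellorder})"
  by (rule trec_limit) (auto intro!: arg_cong[where f = g])

lemma oadd_ozero: "oadd a ozero = a" and oadd_osuc: "oadd a (osuc b) = osuc (oadd a b)"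
  and oadd_limit: "is_limit b \<Longrightarrow> oadd a b = osup (oadd a ` {..<b})"
  for a b :: "'o::{wellorder,no_top}"
  unfolding oadd_def by (simp_all add: trec_ozero trec_osuc trec_limit_image)

lemma omult_ozero: "omult a ozero = ozero" and omult_osuc: "omult a (osuc b) = oadd (omult a b) a"
  and omult_limit: "is_limit b \<Longrightarrow> omult a b = osup (omult a ` {..<b})"
  for a b :: "'o::{wellorder,no_top}"
  unfolding omult_def by (simp_all add: trec_ozero trec_osuc trec_limit_image)

lemma omega_power_ozero: "omega_power (ozero :: 'o) = osuc ozero"
  and omega_power_osuc: "omega_power (osuc b) = omult (omega_power b) omega"
  and omega_power_limit: "is_limit b \<Longrightarrow> omega_power b = osup (omega_power ` {..<b})"
  for b :: "'o::{wellorder,no_top}"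
  unfolding omega_power_def by (simp_all add: trec_ozero trec_osuc trec_limit_image)

section \<open>Finite ordinals and omega\<close>

definition ofin :: "nat \<Rightarrow> 'o::wellorder" where
  "ofin n = (osuc ^^ n) ozero"

lemma ofin_0: "ofin 0 = ozero" and ofin_Suc: "ofin (Suc n) = osuc (ofin n)"
  by (simp_all add: ofin_def)

lemma less_ofin_imp_ofin: "x < ofin n \<Longrightarrow> \<exists>m. x = (ofin m :: 'o::{wellorder,no_top})"
proof (induction n)
  case 0
  then show ?case using ozero_le[of x] by (simp add: ofin_0)
next
  case (Suc n)
  then show ?case by (auto simp: ofin_Suc less_osuc_iff le_less)
qed

text \<open>Let \<open>s\<close> be the supremum of the finite ordinals. A predecessor of
  \<open>s\<close> would be finite, and so would \<open>s\<close>; hence \<open>s\<close> is a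
  limit. All smaller ordinals are finite, hence no limits, so \<open>s\<close> is the least
  limit.\<close>

lemma is_limit_omega: "is_limit (omega :: 'u ordinal)"
  and less_omega_imp_ofin: "x < omega \<Longrightarrow> \<exists>n. x = (ofin n :: 'u ordinal)"
proof -
  define s where "s = osup (range (ofin :: nat \<Rightarrow> 'u ordinal))"
  have up: "ofin n < s" for n
  proof -
    have "ofin (Suc n) \<le> s" unfolding s_def by (rule osup_upper) auto
    then show ?thesis by (simp add: ofin_Suc osuc_le_iff)
  qed
  have lt: "\<exists>n. x = ofin n" if "x < s" for x
    using less_osup[of x "range ofin"] that less_ofin_imp_ofin unfolding s_def by blast
  have not_limit: "\<not> is_limit (ofin n :: 'u ordinal)" for n
    by (cases n) (auto simp: ofin_0 ofin_Suc is_limit_def is_osuc_def)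
  have s: "is_limit s"
  proof (cases s rule: ordinal_cases)
    case zero
    then show ?thesis using up[of 0] by (simp add: ofin_0)
  next
    case (suc y)
    then obtain n where "y = ofin n" using lt osuc_greater by metis
    then show ?thesis using up[of "Suc n"] suc by (simp add: ofin_Suc)
  qed
  have "omega = s"
    unfolding omega_def by (rule Least_equality) (use s lt not_limit in \<open>auto intro: leI\<close>)
  then show "is_limit (omega :: 'u ordinal)" "x < omega \<Longrightarrow> \<exists>n. x = (ofin n :: 'u ordinal)"
    using s lt by auto
qed

lemma countable_omega: "countable_ordinal (omega :: 'u ordinal)"
proof -
  have "{..<omega :: 'u ordinal} \<subseteq> range ofin" using less_omega_imp_ofin by blast
  then show ?thesis unfolding countable_ordinal_def by (rule countable_subset) simp
qed

section \<open>Arithmetic of countable ordinals and powers of omega\<close>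

lemma countable_oadd:
  "countable_ordinal b \<Longrightarrow> countable_ordinal a \<Longrightarrow> countable_ordinal (oadd a b)"
  for a b :: "'o::{wellorder,no_top}"
proof (induction b rule: ordinal_induct)
  case (suc y)
  then have "countable_ordinal y" using countable_ordinal_osucD by blast
  then show ?case using suc by (simp add: oadd_osuc countable_ordinal_osuc)
next
  case (limit x)
  then have "countable_ordinal y" if "y < x" for y
    using countable_ordinal_mono[of x] less_imp_le[OF that] by blast
  then show ?case
    using limit unfolding oadd_limit[OF limit(1)]
    by (intro countable_ordinal_osup) (auto simp: countable_ordinal_def[of x])
qed (simp add: oadd_ozero)

lemma countable_omult:
  "countable_ordinal b \<Longrightarrow> countable_ordinal a \<Longrightarrow> countable_ordinal (omult a b)"
  for a b :: "'o::{wellorder,no_top}"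
proof (induction b rule: ordinal_induct)
  case (suc y)
  then have "countable_ordinal y" using countable_ordinal_osucD by blast
  then show ?case using suc by (simp add: omult_osuc countable_oadd)
next
  case (limit x)
  then have "countable_ordinal y" if "y < x" for y
    using countable_ordinal_mono[of x] less_imp_le[OF that] by blast
  then show ?case
    using limit unfolding omult_limit[OF limit(1)]
    by (intro countable_ordinal_osup) (auto simp: countable_ordinal_def[of x])
qed (simp add: omult_ozero countable_ordinal_ozero)

lemma countable_omega_power:
  "countable_ordinal b \<Longrightarrow> countable_ordinal (omega_power b)" for b :: "'u ordinal"
proof (induction b rule: ordinal_induct)
  case (suc y)
  then have "countable_ordinal y" using countable_ordinal_osucD by blast
  then show ?case using suc by (simp add: omega_power_osuc countable_omult countable_omega)
next
  case (limit x)
  then have "countable_ordinal y" if "y < x" for y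
    using countable_ordinal_mono[of x] less_imp_le[OF that] by blast
  then show ?case
    using limit unfolding omega_power_limit[OF limit(1)]
    by (intro countable_ordinal_osup) (auto simp: countable_ordinal_def[of x])
qed (simp add: omega_power_ozero countable_ordinal_osuc countable_ordinal_ozero)

text \<open>Without a largest member the supremum lies strictly above all members. A predecessor of
  it would lie below some member, and that member would already reach the supremum.\<close>

lemma is_limit_osup:
  fixes A :: "'u ordinal set"
  assumes "countable A" "A \<noteq> {}" "\<And>a. a \<in> A \<Longrightarrow> \<exists>b\<in>A. a < b"
  shows "is_limit (osup A)"
proof -
  have less: "a < osup A" if a: "a \<in> A" for a
  proof -
    obtain b where "b \<in> A" "a < b" using assms(3)[OF a] by blast
    then show ?thesis using osup_upper[OF assms(1), of b] by simp
  qed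
  show ?thesis
  proof (cases "osup A" rule: ordinal_cases)
    case zero
    then show ?thesis using less assms(2) ozero_le leD by (metis ex_in_conv)
  next
    case (suc y)
    then obtain a where "a \<in> A" "y < a" using less_osup[of y A] osuc_greater by metis
    then have "osup A \<le> a" using suc by (simp add: osuc_le_iff)
    then show ?thesis using less[OF \<open>a \<in> A\<close>] by simp
  qed
qed

text \<open>At a limit, the successor of \<open>a\<close> is \<open>oadd a (osuc ozero)\<close> and
  thus among the ordinals whose supremum is taken.\<close>

lemma oadd_greater:
  "countable_ordinal b \<Longrightarrow> b \<noteq> ozero \<Longrightarrow> a < oadd a b" for a b :: "'u ordinal"
proof (induction b rule: ordinal_induct)
  case (suc y)
  then have "countable_ordinal y" using countable_ordinal_osucD by blast
  then have "a \<le> oadd a y" using suc by (cases "y = ozero") (auto simp: oadd_ozero less_imp_le)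
  then show ?case by (simp add: oadd_osuc less_osuc_iff)
next
  case (limit x)
  have "osuc ozero < x" using limit limit_osuc_less ozero_less_limit by blast
  then have "oadd a (osuc ozero) \<le> oadd a x"
    unfolding oadd_limit[OF limit(1)] using limit(3) by (intro osup_upper) (auto simp: countable_ordinal_def)
  then show ?case by (simp add: oadd_osuc oadd_ozero osuc_le_iff)
qed simp

lemma countable_omult_omega_image:
  "countable (omult a ` {..<omega :: 'u ordinal})"
  using countable_omega unfolding countable_ordinal_def by auto

text \<open>Consecutive finite multiples of \<open>a\<close> increase strictly, so they have no
  maximum and their supremum is a limit. It exceeds \<open>a\<close> because the second multiple
  already does.\<close>

lemma
  fixes a :: "'u ordinal"
  assumes "countable_ordinal a" "a \<noteq> ozero"
  shows is_limit_omult_omega: "is_limit (omult a omega)"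
    and less_omult_omega: "a < omult a omega"
proof -
  let ?A = "omult a ` {..<omega}"
  have next_less: "omult a y < omult a (osuc y)" for y
    unfolding omult_osuc using assms by (rule oadd_greater)
  have closed: "osuc y < omega" if "y < omega" for y :: "'u ordinal"
    using that is_limit_omega limit_osuc_less by blast
  have 0: "ozero < (omega :: 'u ordinal)" using is_limit_omega ozero_less_limit by blast
  have eq: "omult a omega = osup ?A" using omult_limit is_limit_omega by blast
  show "is_limit (omult a omega)"
    unfolding eq by (rule is_limit_osup) (use countable_omult_omega_image next_less closed 0 in auto)
  \<comment> \<open>The first multiple \<open>omult a (osuc ozero)\<close> unfolds to
    \<open>oadd ozero a\<close>, which has to be compared with \<open>a\<close>.\<close>
  have "a \<le> oadd ozero a"
  proof -
    have "b \<le> oadd ozero b" if "countable_ordinal b" for b :: "'u ordinal"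
      using that
    proof (induction b rule: ordinal_induct)
      case (suc y)
      then have "countable_ordinal y" using countable_ordinal_osucD by blast
      then show ?case using suc by (simp add: oadd_osuc osuc_le_iff less_osuc_iff)
    next
      case (limit x)
      show ?case
      proof (rule ccontr)
        \<comment> \<open>Put \<open>y = oadd ozero x\<close>. Then \<open>osuc y\<close> is an
          index below \<open>x\<close>, whence \<open>osuc (oadd ozero y) \<le> y\<close>; the
          induction hypothesis \<open>y \<le> oadd ozero y\<close> contradicts this.\<close>
        assume "\<not> x \<le> oadd ozero x"
        then have lt: "oadd ozero x < x" by simp
        then have "osuc (oadd ozero x) < x" using limit limit_osuc_less by blast
        then have "oadd ozero (osuc (oadd ozero x)) \<le> oadd ozero x"
          unfolding oadd_limit[OF limit(1)] using limit(3)
          by (intro osup_upper) (auto simp: countable_ordinal_def)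
        moreover have "oadd ozero x \<le> oadd ozero (oadd ozero x)"
          using limit(2)[OF lt] countable_ordinal_mono[OF limit(3)] lt by simp
        ultimately show False by (simp add: oadd_osuc osuc_le_iff)
      qed
    qed (simp add: ozero_le)
    then show ?thesis using assms by blast
  qed
  also have "\<dots> = omult a (osuc ozero)" by (simp add: omult_osuc omult_ozero)
  also have "\<dots> < omult a (osuc (osuc ozero))" by (rule next_less)
  also have "\<dots> \<le> osup ?A" using countable_omult_omega_image closed 0 by (intro osup_upper) auto
  finally show "a < omult a omega" using eq by simp
qed

lemma omega_power_neq_ozero:
  "countable_ordinal b \<Longrightarrow> omega_power b \<noteq> (ozero :: 'u ordinal)"
proof (induction b rule: ordinal_induct)
  case (suc y)
  then have "countable_ordinal y" using countable_ordinal_osucD by blast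
  then have "is_limit (omega_power (osuc y))"
    using suc unfolding omega_power_osuc by (intro is_limit_omult_omega countable_omega_power)
  then show ?case by (simp add: is_limit_def)
next
  case (limit x)
  then have "omega_power ozero \<le> omega_power x"
    unfolding omega_power_limit[OF limit(1)]
    by (intro osup_upper) (auto simp: countable_ordinal_def ozero_less_limit)
  then show ?case by (auto simp: omega_power_ozero osuc_le_iff)
qed (simp add: omega_power_ozero osuc_neq_ozero)

text \<open>This selects the limit clause of \<open>M_space\<close> for nonzero exponents. Successor
  exponents give a product with \<open>omega\<close>; below a limit exponent the powers have no
  largest one.\<close>

lemma is_limit_omega_power:
  fixes b :: "'u ordinal"
  assumes "countable_ordinal b" "b \<noteq> ozero"
  shows "is_limit (omega_power b)"
proof (cases b rule: ordinal_cases)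
  case zero
  then show ?thesis using assms by simp
next
  case (suc y)
  then have "countable_ordinal y"
    using assms countable_ordinal_osucD by blast
  then show ?thesis
    unfolding suc omega_power_osuc
    by (intro is_limit_omult_omega countable_omega_power omega_power_neq_ozero)
next
  case limit
  have "omega_power y < omega_power (osuc y)" "osuc y < b" if "y < b" for y
  proof -
    have "countable_ordinal y" using assms(1) that countable_ordinal_mono less_imp_le by metis
    then show "omega_power y < omega_power (osuc y)"
      unfolding omega_power_osuc
      by (intro less_omult_omega countable_omega_power omega_power_neq_ozero)
    show "osuc y < b" using limit that limit_osuc_less by blast
  qed
  then show ?thesis
    unfolding omega_power_limit[OF limit] using assms ozero_less_limit[OF limit]
    by (intro is_limit_osup) (auto simp: countable_ordinal_def)
qed

section \<open>Transfinite iteration\<close>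

lemma iterate_ozero: "iterate D F ozero = F"
  and iterate_osuc: "iterate D F (osuc b) = D (iterate D F b)"
  and iterate_limit: "is_limit b \<Longrightarrow> iterate D F b = (\<Inter>c<b. iterate D F c)"
  for b :: "'o::{wellorder,no_top}"
  unfolding iterate_def by (simp_all add: trec_ozero trec_osuc trec_limit_image)

section \<open>Decreasing derivations: cofinal indices and sums of indices\<close>

lemma iterate_antimono:
  fixes b c :: "'o::{wellorder,no_top}"
  assumes "\<And>G. D G \<subseteq> G" and "b \<le> c"
  shows "iterate D F c \<subseteq> iterate D F b"
  using assms(2)
proof (induction c rule: ordinal_induct)
  case zero
  then have "b = ozero" using ozero_le[of b] by (rule order_antisym)
  then show ?case by simp
next
  case (suc c)
  show ?case
  proof (cases "b = osuc c")
    case False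
    then have "b \<le> c" using suc(2) less_osuc_iff by (metis order_le_less)
    then show ?thesis using suc(1) assms(1)[of "iterate D F c"] by (simp add: iterate_osuc)
  qed simp
next
  case (limit c)
  show ?case
  proof (cases "b = c")
    case False
    then show ?thesis using limit.prems unfolding iterate_limit[OF limit(1)] by (intro INT_lower) simp
  qed simp
qed

text \<open>The iterates decrease, so any cofinal family of indices has the same intersection. It is
  applied to fundamental sequences and to the sums \<open>oadd b y\<close>.\<close>

lemma iterate_limit_cofinal:
  fixes b :: "'o::{wellorder,no_top}"
  assumes "\<And>G. D G \<subseteq> G" and "is_limit b"
    and "\<And>i. i \<in> I \<Longrightarrow> s i < b" "\<And>c. c < b \<Longrightarrow> \<exists>i\<in>I. c \<le> s i"
  shows "iterate D F b = (\<Inter>i\<in>I. iterate D F (s i))"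
proof (intro equalityI INT_greatest)
  show "iterate D F b \<subseteq> iterate D F (s i)" if "i \<in> I" for i
    using assms(3)[OF that] by (intro iterate_antimono[OF assms(1)]) simp
  have "(\<Inter>i\<in>I. iterate D F (s i)) \<subseteq> iterate D F c" if c: "c < b" for c
  proof -
    obtain i where "i \<in> I" "c \<le> s i" using assms(4)[OF c] by blast
    then show ?thesis using iterate_antimono[where D = D and F = F, OF assms(1)] by blast
  qed
  then show "(\<Inter>i\<in>I. iterate D F (s i)) \<subseteq> iterate D F b"
    unfolding iterate_limit[OF assms(2)] by blast
qed

text \<open>Monotonicity of \<open>D\<close> is asked for below \<open>F\<close> only, since the
  Szlenk derivation is shown to be monotone on bounded sets.\<close>

lemma iterate_oadd_subset:
  fixes b c :: "'u ordinal"
  assumes "\<And>G. D G \<subseteq> G" and mono: "\<And>G H. G \<subseteq> H \<Longrightarrow> H \<subseteq> F \<Longrightarrow> D G \<subseteq> D H"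
    and "countable_ordinal c"
  shows "iterate D (iterate D F b) c \<subseteq> iterate D F (oadd b c)"
  using assms(3)
proof (induction c rule: ordinal_induct)
  case zero
  then show ?case by (simp add: iterate_ozero oadd_ozero)
next
  case (suc c)
  then have "countable_ordinal c" using countable_ordinal_osucD by blast
  moreover have "iterate D F (oadd b c) \<subseteq> F"
    using iterate_antimono[where D = D and F = F and b = ozero, OF assms(1) ozero_le]
    by (simp add: iterate_ozero)
  ultimately show ?case using suc by (simp add: iterate_osuc oadd_osuc mono)
next
  case (limit c)
  \<comment> \<open>Strict growth at successors leaves the sums \<open>oadd b y\<close> without a
    maximum, so \<open>oadd b c\<close> is again a limit and these sums are cofinal in it.\<close>
  have cof: "oadd b y < oadd b (osuc y)" "osuc y < c" if "y < c" for y
    using limit_osuc_less[OF limit(1) that] by (auto simp: oadd_osuc osuc_greater)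
  have cnt: "countable (oadd b ` {..<c})" using limit(3) by (auto simp: countable_ordinal_def)
  have "is_limit (oadd b c)"
    unfolding oadd_limit[OF limit(1)] using cnt ozero_less_limit[OF limit(1)] cof
    by (intro is_limit_osup) auto
  moreover have "oadd b y < oadd b c" if "y < c" for y
  proof -
    have "oadd b (osuc y) \<le> oadd b c"
      unfolding oadd_limit[OF limit(1)] using cnt cof[OF that] by (intro osup_upper) auto
    then show ?thesis using cof(1)[OF that] by simp
  qed
  moreover have "\<exists>y\<in>{..<c}. e \<le> oadd b y" if e: "e < oadd b c" for e
  proof -
    obtain y where "y < c" "e < oadd b y"
      using less_osup[of e "oadd b ` {..<c}"] e unfolding oadd_limit[OF limit(1)] by auto
    then show ?thesis using less_imp_le by blast
  qed
  ultimately have "iterate D F (oadd b c) = (\<Inter>y\<in>{..<c}. iterate D F (oadd b y))"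
    by (intro iterate_limit_cofinal assms(1)) auto
  moreover have "iterate D (iterate D F b) y \<subseteq> iterate D F (oadd b y)" if "y < c" for y
    using limit(2)[OF that] countable_ordinal_mono[OF limit(3)] that by simp
  ultimately show ?case unfolding iterate_limit[OF limit(1)] by blast
qed

section \<open>Norming functionals and weak* compactness\<close>

definition sublinear :: "('a::real_vector \<Rightarrow> real) \<Rightarrow> bool" where
  "sublinear p \<longleftrightarrow> (\<forall>x y. p (x + y) \<le> p x + p y) \<and> (\<forall>c>0. \<forall>x. p (c *\<^sub>R x) = c * p x)"

lemma sublinear_zero: "sublinear p \<Longrightarrow> p 0 = 0"
proof -
  assume "sublinear p"
  then have "p (2 *\<^sub>R 0) = 2 * p 0" unfolding sublinear_def by (meson zero_less_numeral)
  then show ?thesis by simp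
qed

lemma sublinear_minus: "sublinear p \<Longrightarrow> - p (- y) \<le> p y"
proof -
  assume p: "sublinear p"
  then have "p (y + - y) \<le> p y + p (- y)" unfolding sublinear_def by blast
  then show ?thesis using sublinear_zero[OF p] by simp
qed

text \<open>The standard minorant of \<open>p\<close> in the Hahn-Banach argument: it stays below
  \<open>p\<close> and is at most \<open>- p x\<close> at \<open>- x\<close>.\<close>

definition directional :: "('a::real_vector \<Rightarrow> real) \<Rightarrow> 'a \<Rightarrow> 'a \<Rightarrow> real" where
  "directional p x y = (INF t\<in>{0..}. p (y + t *\<^sub>R x) - t * p x)"

context
  fixes p :: "'a::real_vector \<Rightarrow> real" and x :: 'a
  assumes p: "sublinear p"
begin

text \<open>A lower bound independent of \<open>t\<close>, so that the infimum in
  \<open>directional\<close> is taken over a set bounded below.\<close>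

lemma directional_aux: "- p (- y) \<le> p (y + t *\<^sub>R x) - t * p x" if "t \<ge> 0"
proof (cases "t = 0")
  case True
  then show ?thesis using sublinear_minus[OF p] by simp
next
  case False
  have "p ((y + t *\<^sub>R x) + (- y)) \<le> p (y + t *\<^sub>R x) + p (- y)"
    using p unfolding sublinear_def by blast
  moreover have "p (t *\<^sub>R x) = t * p x" using p False that unfolding sublinear_def by simp
  ultimately show ?thesis by simp
qed

lemma directional_bdd: "bdd_below ((\<lambda>t. p (y + t *\<^sub>R x) - t * p x) ` {0..})"
  using directional_aux by (intro bdd_belowI2) auto

lemma directional_le: "t \<ge> 0 \<Longrightarrow> directional p x y \<le> p (y + t *\<^sub>R x) - t * p x"
  unfolding directional_def by (rule cINF_lower[OF directional_bdd]) simp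

lemma directional_le_self: "directional p x y \<le> p y"
  using directional_le[of 0 y] by simp

lemma directional_minus: "directional p x (- x) \<le> - p x"
  using directional_le[of 1 "- x"] sublinear_zero[OF p] by simp

lemma sublinear_directional: "sublinear (directional p x)"
proof -
  let ?q = "directional p x"
  have add: "?q (y + z) \<le> ?q y + ?q z" for y z
  proof -
    \<comment> \<open>A parameter \<open>t\<close> for \<open>y\<close> and a parameter
      \<open>s\<close> for \<open>z\<close> combine to the parameter \<open>s + t\<close> for
      \<open>y + z\<close>.\<close>
    have 1: "?q (y + z) - (p (z + s *\<^sub>R x) - s * p x) \<le> p (y + t *\<^sub>R x) - t * p x"
      if "s \<ge> 0" "t \<ge> 0" for s t
    proof -
      have "?q (y + z) \<le> p ((y + z) + (s + t) *\<^sub>R x) - (s + t) * p x"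
        using that by (intro directional_le) simp
      moreover have "p ((y + t *\<^sub>R x) + (z + s *\<^sub>R x)) \<le> p (y + t *\<^sub>R x) + p (z + s *\<^sub>R x)"
        using p unfolding sublinear_def by blast
      ultimately show ?thesis by (simp add: algebra_simps)
    qed
    have "?q (y + z) - (p (z + s *\<^sub>R x) - s * p x) \<le> ?q y" if "s \<ge> 0" for s
      unfolding directional_def[of p x y] using 1[OF that] by (intro cINF_greatest) auto
    then have "?q (y + z) - ?q y \<le> p (z + s *\<^sub>R x) - s * p x" if "s \<ge> 0" for s
      using that by (simp add: algebra_simps)
    then have "?q (y + z) - ?q y \<le> ?q z"
      unfolding directional_def[of p x z] by (intro cINF_greatest) auto
    then show ?thesis by simp
  qed
  \<comment> \<open>Replacing the parameter \<open>t\<close> by \<open>t / c\<close> gives one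
    inequality; the other follows by applying it to \<open>inverse c\<close> and
    \<open>c *\<^sub>R y\<close>.\<close>
  have ge: "c * ?q y \<le> ?q (c *\<^sub>R y)" if "c > 0" for c y
    unfolding directional_def[of p x "c *\<^sub>R y"]
  proof (intro cINF_greatest)
    fix t :: real assume "t \<in> {0..}"
    then have "?q y \<le> p (y + (t / c) *\<^sub>R x) - (t / c) * p x"
      using that by (intro directional_le) simp
    then have "c * ?q y \<le> c * p (y + (t / c) *\<^sub>R x) - t * p x"
      using that by (simp add: field_simps)
    also have "c * p (y + (t / c) *\<^sub>R x) = p (c *\<^sub>R (y + (t / c) *\<^sub>R x))"
      using p that unfolding sublinear_def by simp
    finally show "c * ?q y \<le> p (c *\<^sub>R y + t *\<^sub>R x) - t * p x"
      using that by (simp add: scaleR_add_right)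
  qed simp
  have "?q (c *\<^sub>R y) = c * ?q y" if "c > 0" for c y
  proof -
    have "inverse c * ?q (c *\<^sub>R y) \<le> ?q y" using ge[of "inverse c" "c *\<^sub>R y"] that by simp
    then have "?q (c *\<^sub>R y) \<le> c * ?q y" using that by (simp add: field_simps)
    then show ?thesis using ge[OF that, of y] by simp
  qed
  then show ?thesis using add unfolding sublinear_def by blast
qed

end

text \<open>By Zorn's lemma: the pointwise infimum of a nonempty chain below \<open>p\<close> is
  again sublinear. It is finite because every sublinear \<open>q \<le> p\<close> satisfies
  \<open>- p (- y) \<le> q y\<close>.\<close>

lemma minimal_sublinear_exists:
  fixes p :: "'a::real_vector \<Rightarrow> real"
  assumes "sublinear p"
  obtains q where "sublinear q" "q \<le> p" "\<And>r. sublinear r \<Longrightarrow> r \<le> q \<Longrightarrow> r = q"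
proof -
  define A where "A = {q. sublinear q \<and> q \<le> p}"
  have low: "- p (- y) \<le> q y" if "q \<in> A" for q y
  proof -
    have "sublinear q" "q (- y) \<le> p (- y)" using that by (auto simp: A_def le_fun_def)
    then show ?thesis using sublinear_minus[of q y] by linarith
  qed
  have "\<exists>m\<in>A. \<forall>a\<in>A. a \<le> m \<longrightarrow> a = m"
  proof (rule predicate_Zorn)
    \<comment> \<open>The order is reversed, so that the maximal element supplied by Zorn is a
      minimal functional.\<close>
    show "partial_order_on A (relation_of (\<lambda>x y. y \<le> x) A)"
      by (auto simp: partial_order_on_def preorder_on_def refl_on_def trans_def antisym_def relation_of_def)
    fix C assume C: "C \<in> Chains (relation_of (\<lambda>x y. y \<le> x) A)"
    then have CA: "C \<subseteq> A" by (auto simp: Chains_def relation_of_def)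
    have tot: "r \<le> s \<or> s \<le> r" if "r \<in> C" "s \<in> C" for r s
      using C that by (auto simp: Chains_def relation_of_def)
    show "\<exists>u\<in>A. \<forall>a\<in>C. u \<le> a"
    proof (cases "C = {}")
      case True
      then show ?thesis using assms by (auto simp: A_def)
    next
      case False
      define u where "u y = (INF q\<in>C. q y)" for y
      have bdd: "bdd_below ((\<lambda>q. q y) ` C)" for y
        using low CA by (intro bdd_belowI2) blast
      have le: "u y \<le> q y" if "q \<in> C" for q y
        unfolding u_def using bdd that by (rule cINF_lower)
      \<comment> \<open>Being in a chain matters here: of two members \<open>r\<close> and
        \<open>s\<close>, the smaller one is evaluated at both \<open>y\<close> and
        \<open>z\<close>.\<close>
      have add: "u (y + z) \<le> u y + u z" for y z
      proof -
        have 1: "u (y + z) \<le> r y + s z" if rs: "r \<in> C" "s \<in> C" for r s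
        proof -
          obtain q where q: "q \<in> C" "q \<le> r" "q \<le> s" using tot[OF rs] rs by blast
          have "u (y + z) \<le> q (y + z)" using le q by blast
          also have "\<dots> \<le> q y + q z" using q CA unfolding A_def sublinear_def by blast
          also have "\<dots> \<le> r y + s z" using q by (auto simp: le_fun_def intro: add_mono)
          finally show ?thesis .
        qed
        have "u (y + z) - s z \<le> u y" if "s \<in> C" for s
          unfolding u_def[of y]
        proof (intro cINF_greatest)
          fix r assume "r \<in> C"
          then show "u (y + z) - s z \<le> r y" using 1[OF _ that, of r] by simp
        qed (rule False)
        then have "u (y + z) - u y \<le> s z" if "s \<in> C" for s
          using that by (simp add: algebra_simps)
        then have "u (y + z) - u y \<le> u z"
          unfolding u_def[of z] using False by (intro cINF_greatest)
        then show ?thesis by simp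
      qed
      have ge: "c * u y \<le> u (c *\<^sub>R y)" if "c > 0" for c y
        unfolding u_def[of "c *\<^sub>R y"]
      proof (intro cINF_greatest)
        fix q assume q: "q \<in> C"
        then have "q (c *\<^sub>R y) = c * q y" using CA that unfolding A_def sublinear_def by blast
        then show "c * u y \<le> q (c *\<^sub>R y)" using le[OF q, of y] that by simp
      qed (rule False)
      have "u (c *\<^sub>R y) = c * u y" if "c > 0" for c y
      proof -
        have "inverse c * u (c *\<^sub>R y) \<le> u y" using ge[of "inverse c" "c *\<^sub>R y"] that by simp
        then have "u (c *\<^sub>R y) \<le> c * u y" using that by (simp add: field_simps)
        then show ?thesis using ge[OF that, of y] by simp
      qed
      then have "sublinear u" using add unfolding sublinear_def by blast
      moreover have "u \<le> p"
      proof -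
        obtain q where "q \<in> C" using False by blast
        then have "u \<le> q" "q \<le> p" using le[of q] CA by (auto simp: A_def le_fun_def)
        then show ?thesis by (rule order_trans)
      qed
      ultimately show ?thesis using le by (auto simp: A_def le_fun_def)
    qed
  qed
  then obtain m where m: "m \<in> A" "\<And>a. a \<in> A \<Longrightarrow> a \<le> m \<Longrightarrow> a = m" by blast
  show ?thesis
  proof (rule that[of m])
    show "sublinear m" "m \<le> p" using m(1) by (auto simp: A_def)
    show "r = m" if "sublinear r" "r \<le> m" for r
      using m that by (auto simp: A_def)
  qed
qed

text \<open>A minimal sublinear functional agrees with each of its directional modifications, hence is
  odd and therefore linear.\<close>

lemma norming_functional:
  fixes v :: "'a::real_normed_vector"
  obtains \<phi> :: "'a \<Rightarrow>\<^sub>L real" where "norm \<phi> \<le> 1" "\<phi> v = norm v"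
proof -
  have N: "sublinear (norm :: 'a \<Rightarrow> real)"
    unfolding sublinear_def using norm_triangle_ineq by auto
  \<comment> \<open>Starting below \<open>directional norm v\<close> rather than below
    \<open>norm\<close> forces \<open>q (- v) \<le> - norm v\<close>, so \<open>q\<close> attains
    the norm at \<open>v\<close>.\<close>
  obtain q where q: "sublinear q" "q \<le> directional norm v"
    and min: "\<And>r. sublinear r \<Longrightarrow> r \<le> q \<Longrightarrow> r = q"
    using minimal_sublinear_exists[OF sublinear_directional[OF N, of v]] by blast
  have qN: "q y \<le> norm y" for y
    using q(2) directional_le_self[OF N, of v y] unfolding le_fun_def by (meson order_trans)
  have odd: "q (- x) = - q x" for x
  proof -
    have "directional q x = q"
      using min sublinear_directional[OF q(1)] directional_le_self[OF q(1)] by (simp add: le_fun_def)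
    then have "q (- x) \<le> - q x" using directional_minus[OF q(1), of x] by simp
    then show ?thesis using sublinear_minus[OF q(1), of "- x"] by simp
  qed
  have add: "q (x + y) = q x + q y" for x y
  proof -
    have "q (- x + - y) \<le> q (- x) + q (- y)" using q(1) unfolding sublinear_def by blast
    then have "- q (x + y) \<le> - q x - q y" using odd[of "x + y"] odd[of x] odd[of y] by simp
    moreover have "q (x + y) \<le> q x + q y" using q(1) unfolding sublinear_def by blast
    ultimately show ?thesis by simp
  qed
  have pos: "q (c *\<^sub>R x) = c * q x" if "c > 0" for c x
    using q(1) that unfolding sublinear_def by blast
  have scale: "q (c *\<^sub>R x) = c * q x" for c x
  proof -
    consider "c > 0" | "c = 0" | "- c > 0" by linarith
    then show ?thesis
    proof cases
      case 3
      then show ?thesis using pos[of "- c" x] odd[of "c *\<^sub>R x"] by simp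
    qed (use pos sublinear_zero[OF q(1)] in auto)
  qed
  have bound: "norm (q x) \<le> norm x * 1" for x
    using qN[of x] qN[of "- x"] odd[of x] by simp
  have bl: "bounded_linear q"
    by (rule bounded_linear_intro[where K = 1]) (use add scale bound in auto)
  have "q (- v) \<le> - norm v"
    using q(2) directional_minus[OF N, of v] unfolding le_fun_def by (meson order_trans)
  then have "q v = norm v" using odd[of v] qN[of v] by simp
  moreover have "norm (Blinfun q) \<le> 1"
    using bound by (intro norm_blinfun_bound) (auto simp: bounded_linear_Blinfun_apply[OF bl])
  ultimately show ?thesis
    using that[of "Blinfun q"] by (simp add: bounded_linear_Blinfun_apply[OF bl])
qed

section \<open>Weak* compactness of the dual ball\<close>

text \<open>By Tychonoff the product of the intervals of radius \<open>norm x\<close> is compact,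
  and additivity and homogeneity are closed conditions in the product topology.\<close>

lemma compact_linear_functionals:
  "compact {g :: 'a::real_normed_vector \<Rightarrow> real. linear g \<and> (\<forall>x. \<bar>g x\<bar> \<le> norm x)}"
proof -
  have ev: "continuous_on UNIV (\<lambda>g :: 'a \<Rightarrow> real. g x)" for x
    by (rule continuous_on_product_coordinates)
  have "compactin (product_topology (\<lambda>i::'a. euclidean) UNIV) (PiE UNIV (\<lambda>x::'a. cball (0::real) (norm x)))"
    by (simp add: compactin_PiE)
  then have "compact (PiE UNIV (\<lambda>x::'a. cball (0::real) (norm x)))"
    unfolding euclidean_product_topology compactin_euclidean_iff .
  moreover have "closed {g :: 'a \<Rightarrow> real. \<forall>x y. g (x + y) = g x + g y}"
    by (intro closed_Collect_all closed_Collect_eq continuous_intros ev)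
  moreover have "closed {g :: 'a \<Rightarrow> real. \<forall>c x. g (c *\<^sub>R x) = c * g x}"
    by (intro closed_Collect_all closed_Collect_eq continuous_intros ev)
  ultimately have "compact ((PiE UNIV (\<lambda>x::'a. cball (0::real) (norm x)) \<inter>
      {g. \<forall>x y. g (x + y) = g x + g y}) \<inter> {g. \<forall>c x. g (c *\<^sub>R x) = c * g x})"
    by (intro compact_Int_closed)
  moreover have "(PiE UNIV (\<lambda>x::'a. cball (0::real) (norm x)) \<inter>
      {g. \<forall>x y. g (x + y) = g x + g y}) \<inter> {g. \<forall>c x. g (c *\<^sub>R x) = c * g x} =
      {g. linear g \<and> (\<forall>x. \<bar>g x\<bar> \<le> norm x)}"
    by (auto simp: PiE_iff dist_norm linear_iff)
  ultimately show ?thesis by simp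
qed

text \<open>The weak* topology is the pullback of the product topology along
  \<open>blinfun_apply\<close>, which maps the ball onto the compact set of the preceding lemma.
  Open covers are pushed forward and finite subcovers pulled back.\<close>

lemma banach_alaoglu: "compactin weak_star (cball (0 :: 'a::real_normed_vector \<Rightarrow>\<^sub>L real) 1)"
  unfolding compactin_def
proof (intro conjI allI impI)
  show "cball (0 :: 'a \<Rightarrow>\<^sub>L real) 1 \<subseteq> topspace weak_star"
    by (simp add: strong_operator_topology_topspace)
  fix \<U> :: "('a \<Rightarrow>\<^sub>L real) set set"
  assume U: "(\<forall>U\<in>\<U>. openin weak_star U) \<and> cball 0 1 \<subseteq> \<Union> \<U>"
  let ?B = "{g :: 'a \<Rightarrow> real. linear g \<and> (\<forall>x. \<bar>g x\<bar> \<le> norm x)}"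
  have img: "blinfun_apply ` cball 0 1 = ?B"
  proof (intro equalityI subsetI)
    fix g assume "g \<in> blinfun_apply ` cball (0 :: 'a \<Rightarrow>\<^sub>L real) 1"
    then obtain \<phi> :: "'a \<Rightarrow>\<^sub>L real" where \<phi>: "norm \<phi> \<le> 1" "g = \<phi>" by (auto simp: dist_norm)
    have "\<bar>\<phi> x\<bar> \<le> norm x" for x
      using norm_blinfun[of \<phi> x] \<phi>(1) mult_right_mono[of "norm \<phi>" 1 "norm x"] by simp
    then show "g \<in> ?B" using \<phi>(2) blinfun.bounded_linear_right bounded_linear.linear by blast
  next
    fix g assume g: "g \<in> ?B"
    then have bl: "bounded_linear g"
      by (intro bounded_linear_intro[of g 1]) (auto simp: linear_iff)
    have "norm (Blinfun g) \<le> 1"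
      using g by (intro norm_blinfun_bound) (auto simp: bounded_linear_Blinfun_apply[OF bl])
    then show "g \<in> blinfun_apply ` cball 0 1"
      using bounded_linear_Blinfun_apply[OF bl] by (intro image_eqI[of _ _ "Blinfun g"]) auto
  qed
  have "\<exists>W. open W \<and> U = blinfun_apply -` W" if "U \<in> \<U>" for U
    using U that unfolding strong_operator_topology_def by (auto simp: openin_pullback_topology)
  then obtain W where W: "\<And>U. U \<in> \<U> \<Longrightarrow> open (W U) \<and> U = blinfun_apply -` W U" by metis
  have "?B \<subseteq> \<Union> (W ` \<U>)"
    unfolding img[symmetric] using U W by blast
  moreover have "open (W U)" if "U \<in> \<U>" for U using W that by blast
  ultimately obtain \<F> where F: "\<F> \<subseteq> \<U>" "finite \<F>" "?B \<subseteq> \<Union> (W ` \<F>)"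
    using compactE_image[OF compact_linear_functionals, of \<U> W] by blast
  have "cball 0 1 \<subseteq> \<Union> \<F>"
  proof
    fix \<phi> :: "'a \<Rightarrow>\<^sub>L real" assume "\<phi> \<in> cball 0 1"
    then have "blinfun_apply \<phi> \<in> ?B" using img by blast
    then obtain U where "U \<in> \<F>" "blinfun_apply \<phi> \<in> W U" using F(3) by blast
    then show "\<phi> \<in> \<Union> \<F>" using W F(1) by blast
  qed
  then show "\<exists>\<F>. finite \<F> \<and> \<F> \<subseteq> \<U> \<and> cball 0 1 \<subseteq> \<Union> \<F>" using F by blast
qed

section \<open>Szlenk derivatives\<close>

lemma szlenk_deriv_subset: "szlenk_deriv \<epsilon> F \<subseteq> F"
  unfolding szlenk_deriv_def by blast

lemma mem_szlenk_deriv: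
  "\<phi> \<in> szlenk_deriv \<epsilon> F \<longleftrightarrow> \<phi> \<in> F \<and> (\<forall>V. openin weak_star V \<longrightarrow> \<phi> \<in> V \<longrightarrow> \<epsilon> \<le> diameter (V \<inter> F))"
  unfolding szlenk_deriv_def by (auto simp: not_less)

lemma closedin_szlenk_deriv:
  assumes "closedin weak_star F" shows "closedin weak_star (szlenk_deriv \<epsilon> F)"
  unfolding szlenk_deriv_def using assms by (intro closedin_diff openin_Union) auto

lemma szlenk_deriv_mono:
  assumes "F \<subseteq> G" "bounded G" shows "szlenk_deriv \<epsilon> F \<subseteq> szlenk_deriv \<epsilon> G"
proof
  fix \<phi> assume \<phi>: "\<phi> \<in> szlenk_deriv \<epsilon> F"
  have "diameter (V \<inter> F) \<le> diameter (V \<inter> G)" for V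
    using assms by (intro diameter_subset) (auto intro: bounded_subset)
  moreover have "\<epsilon> \<le> diameter (V \<inter> F)" if "openin weak_star V" "\<phi> \<in> V" for V
    using \<phi> that by (simp add: mem_szlenk_deriv)
  ultimately have "\<epsilon> \<le> diameter (V \<inter> G)" if "openin weak_star V" "\<phi> \<in> V" for V
    using that by (rule_tac order_trans)
  then show "\<phi> \<in> szlenk_deriv \<epsilon> G" using \<phi> assms(1) by (auto simp: mem_szlenk_deriv)
qed

text \<open>The map is weak* continuous and multiplies distances by \<open>c\<close>. A weak*
  neighbourhood of the image point pulls back to one of \<open>\<phi>\<close>, whose trace on
  \<open>F\<close> has diameter at least \<open>\<epsilon>\<close>.\<close>

lemma szlenk_deriv_affine:
  fixes v :: "'a::real_normed_vector \<Rightarrow>\<^sub>L real"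
  assumes "c > 0" "bounded F" "\<phi> \<in> szlenk_deriv \<epsilon> F"
  shows "c *\<^sub>R \<phi> + v \<in> szlenk_deriv (c * \<epsilon>) ((\<lambda>\<psi>. c *\<^sub>R \<psi> + v) ` F)"
  unfolding mem_szlenk_deriv
proof (intro conjI allI impI)
  let ?T = "\<lambda>\<psi>. c *\<^sub>R \<psi> + v"
  show "?T \<phi> \<in> ?T ` F" using assms(3) szlenk_deriv_subset by blast
  fix V assume V: "openin weak_star V" "?T \<phi> \<in> V"
  have "continuous_map weak_star weak_star ?T"
    unfolding continuous_on_strong_operator_topo_iff_coordinatewise
    by (auto simp: blinfun.add_left blinfun.scaleR_left
        intro!: continuous_map_add continuous_map_real_mult strong_operator_topology_continuous_evaluation)
  then have "openin weak_star {\<psi> \<in> topspace weak_star. ?T \<psi> \<in> V}"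
    using V(1) by (rule openin_continuous_map_preimage)
  then have "\<epsilon> \<le> diameter ({\<psi>. ?T \<psi> \<in> V} \<inter> F)"
    using assms(3) V(2) unfolding mem_szlenk_deriv by (simp add: strong_operator_topology_topspace)
  also have "\<dots> \<le> diameter (V \<inter> ?T ` F) / c"
  proof (rule diameter_le)
    have "?T ` F = (\<lambda>\<psi>. v + \<psi>) ` (\<lambda>\<psi>. c *\<^sub>R \<psi>) ` F" by (auto simp: image_image add.commute)
    then have bdd: "bounded (?T ` F)" using assms(2) by (metis bounded_scaling bounded_translation)
    have pos: "0 \<le> diameter (V \<inter> ?T ` F)" using bdd by (intro diameter_ge_0) (auto intro: bounded_subset)
    then show "{\<psi>. ?T \<psi> \<in> V} \<inter> F \<noteq> {} \<or> 0 \<le> diameter (V \<inter> ?T ` F) / c" using assms(1) by simp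
    fix x y assume xy: "x \<in> {\<psi>. ?T \<psi> \<in> V} \<inter> F" "y \<in> {\<psi>. ?T \<psi> \<in> V} \<inter> F"
    then have "dist (?T x) (?T y) \<le> diameter (V \<inter> ?T ` F)"
      using bdd by (intro diameter_bounded_bound) (auto intro: bounded_subset)
    then show "norm (x - y) \<le> diameter (V \<inter> ?T ` F) / c"
    proof -
      have "dist (?T x) (?T y) = norm (c *\<^sub>R (x - y))"
        unfolding dist_norm by (simp add: scaleR_diff_right)
      also have "\<dots> = c * norm (x - y)" using assms(1) by simp
      finally show ?thesis using \<open>dist (?T x) (?T y) \<le> _\<close> assms(1) by (simp add: field_simps)
    qed
  qed
  finally show "c * \<epsilon> \<le> diameter (V \<inter> ?T ` F)" using assms(1) by (simp add: field_simps)
qed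

lemma iterate_szlenk_deriv_subset:
  "iterate (szlenk_deriv \<epsilon>) F (b :: 'o::{wellorder,no_top}) \<subseteq> F"
  using iterate_antimono[where D = "szlenk_deriv \<epsilon>" and F = F, OF szlenk_deriv_subset ozero_le, of b]
  by (simp add: iterate_ozero)

text \<open>Mere inclusion of the image of \<open>F\<close> in \<open>G\<close> suffices by
  monotonicity. This allows shrunken, translated balls to be placed inside larger sets, at the price
  of the factor \<open>c\<close> in \<open>\<epsilon>\<close>.\<close>

lemma iterate_szlenk_deriv_affine:
  fixes b :: "'o::{wellorder,no_top}"
  assumes "c > 0" "bounded G" and T: "(\<lambda>\<psi>. c *\<^sub>R \<psi> + v) ` F \<subseteq> G" "bounded F"
    and "\<phi> \<in> iterate (szlenk_deriv \<epsilon>) F b"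
  shows "c *\<^sub>R \<phi> + v \<in> iterate (szlenk_deriv (c * \<epsilon>)) G b"
  using assms(5)
proof (induction b arbitrary: \<phi> rule: ordinal_induct)
  case zero
  then show ?case using T by (auto simp: iterate_ozero)
next
  case (suc b)
  let ?F = "iterate (szlenk_deriv \<epsilon>) F b" and ?G = "iterate (szlenk_deriv (c * \<epsilon>)) G b"
  have "?F \<subseteq> F" "?G \<subseteq> G"
    by (rule iterate_szlenk_deriv_subset)+
  then have "bounded ?F" "bounded ?G" using assms bounded_subset by blast+
  moreover have "(\<lambda>\<psi>. c *\<^sub>R \<psi> + v) ` ?F \<subseteq> ?G" using suc(1) by blast
  ultimately show ?case
    using szlenk_deriv_affine[OF assms(1), of ?F \<phi> \<epsilon> v] szlenk_deriv_mono suc(2)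
    unfolding iterate_osuc by blast
next
  case (limit b)
  then show ?case by (auto simp: iterate_limit)
qed

section \<open>Iterated derivatives of the dual ball\<close>

lemma szlenk_iter_subset: "szlenk_iter \<epsilon> b \<subseteq> cball 0 1"
  and szlenk_iter_antimono: "b \<le> c \<Longrightarrow> szlenk_iter \<epsilon> c \<subseteq> szlenk_iter \<epsilon> b"
  unfolding szlenk_iter_def
  by (rule iterate_szlenk_deriv_subset, rule iterate_antimono[where D = "szlenk_deriv \<epsilon>", OF szlenk_deriv_subset])

lemma closedin_weak_star_cball: "closedin weak_star (cball (0 :: 'a::real_normed_vector \<Rightarrow>\<^sub>L real) 1)"
proof -
  have "cball (0 :: 'a \<Rightarrow>\<^sub>L real) 1 = (\<Inter>x. {\<phi> \<in> topspace weak_star. \<phi> x \<in> {- norm x..norm x}})"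
  proof (intro equalityI subsetI)
    fix \<phi> :: "'a \<Rightarrow>\<^sub>L real" assume "\<phi> \<in> cball 0 1"
    then have "\<bar>\<phi> x\<bar> \<le> norm x" for x
      using norm_blinfun[of \<phi> x] mult_right_mono[of "norm \<phi>" 1 "norm x"] by simp
    then show "\<phi> \<in> (\<Inter>x. {\<phi> \<in> topspace weak_star. \<phi> x \<in> {- norm x..norm x}})"
      by (auto simp: strong_operator_topology_topspace abs_le_iff) (metis minus_le_iff)
  next
    fix \<phi> :: "'a \<Rightarrow>\<^sub>L real"
    assume "\<phi> \<in> (\<Inter>x. {\<phi> \<in> topspace weak_star. \<phi> x \<in> {- norm x..norm x}})"
    then have "norm \<phi> \<le> 1"
      by (intro norm_blinfun_bound) (auto simp: abs_le_iff minus_le_iff)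
    then show "\<phi> \<in> cball 0 1" by simp
  qed
  moreover have "closedin weak_star {\<phi> \<in> topspace weak_star. blinfun_apply \<phi> x \<in> {- norm x..norm x}}" for x :: 'a
    by (rule closedin_continuous_map_preimage[OF strong_operator_topology_continuous_evaluation]) auto
  ultimately show ?thesis by auto
qed

lemma closedin_szlenk_iter: "closedin weak_star (szlenk_iter \<epsilon> b)"
  unfolding szlenk_iter_def
proof (induction b rule: ordinal_induct)
  case (limit b)
  have "{..<b} \<noteq> {}" using ozero_less_limit[OF limit(1)] by auto
  then show ?case using limit unfolding iterate_limit[OF limit(1)] by (intro closedin_INT) auto
qed (auto simp: iterate_ozero iterate_osuc closedin_weak_star_cball closedin_szlenk_deriv)

section \<open>Gaining a derivative and passing to intersections\<close>

text \<open>The pigeonhole argument in abstract form. \<open>W\<close> carries a closed condition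
  that the surviving functional must satisfy as well. If the derivative missed \<open>W\<close>,
  compactness would cover \<open>K \<inter> W\<close> by finitely many open sets whose traces on all
  of \<open>K\<close> have small diameter.\<close>

lemma szlenk_deriv_meets_closedin:
  fixes u :: "nat \<Rightarrow> nat \<Rightarrow> 'a::real_normed_vector"
  assumes K: "closedin weak_star K" "K \<subseteq> cball 0 1" and W: "closedin weak_star W"
    and "\<eta> > 0" "R > 0" and u: "\<And>k i. 1 \<le> i \<Longrightarrow> i \<le> k \<Longrightarrow> norm (u k i) \<le> R"
    and sep: "\<And>k i j. 1 \<le> i \<Longrightarrow> i \<le> k \<Longrightarrow> 1 \<le> j \<Longrightarrow> j \<le> k \<Longrightarrow> i \<noteq> j \<Longrightarrow>
      \<exists>\<phi>\<in>K \<inter> W. \<eta> \<le> blinfun_apply \<phi> (u k i) - blinfun_apply \<phi> (u k j)"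
  shows "szlenk_deriv (\<eta> / (4 * R)) K \<inter> W \<noteq> {}"
proof
  let ?\<epsilon> = "\<eta> / (4 * R)"
  assume empty: "szlenk_deriv ?\<epsilon> K \<inter> W = {}"
  let ?\<V> = "{V. openin weak_star V \<and> diameter (V \<inter> K) < ?\<epsilon>}"
  have cover: "K \<inter> W \<subseteq> \<Union>?\<V>" using empty unfolding szlenk_deriv_def by blast
  have cball: "\<phi> \<in> cball 0 1 \<Longrightarrow> \<bar>\<phi> x\<bar> \<le> norm x" for \<phi> :: "'a \<Rightarrow>\<^sub>L real" and x
    using norm_blinfun[of \<phi> x] mult_right_mono[of "norm \<phi>" 1 "norm x"] by simp
  have "compactin weak_star (K \<inter> W)"
    using closed_compactin[OF banach_alaoglu] K W by (metis closedin_Int le_infI1)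
  then obtain \<F> where F: "finite \<F>" "\<F> \<subseteq> ?\<V>" "K \<inter> W \<subseteq> \<Union>\<F>"
    using cover unfolding compactin_def by (metis (no_types, lifting) mem_Collect_eq)
  \<comment> \<open>One sample functional for each \<open>V\<close>, taken from
    \<open>V \<inter> K\<close> and not necessarily from \<open>W\<close>. It is arbitrary when
    \<open>V \<inter> K\<close> is empty; \<open>box\<close> then takes the value 0.\<close>
  define \<xi> where "\<xi> V = (SOME \<phi>. \<phi> \<in> V \<inter> K)" for V
  \<comment> \<open>The sample values lie between \<open>-R\<close> and \<open>R\<close>. Cutting
    the line into intervals of length \<open>\<eta> / 2\<close> gives interval numbers from
    \<open>- N - 1\<close> to \<open>N\<close>.\<close>
  define N where "N = \<lceil>2 * R / \<eta>\<rceil>"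
  define box where "box k i = (\<lambda>V\<in>\<F>. if V \<inter> K = {} then 0 else \<lfloor>blinfun_apply (\<xi> V) (u k i) * (2 / \<eta>)\<rfloor>)" for k i
  have \<xi>: "\<xi> V \<in> V \<inter> K" if "V \<inter> K \<noteq> {}" for V
    using that unfolding \<xi>_def by (rule someI_ex[OF ex_in_conv[THEN iffD2]])
  define P where "P = PiE \<F> (\<lambda>_. {- N - 1..N})"
  have "finite P" unfolding P_def using F by (intro finite_PiE) auto
  \<comment> \<open>One vector more than there are possible patterns of interval numbers, so two of
    the \<open>k\<close> vectors share a pattern.\<close>
  define k where "k = Suc (card P)"
  have "box k ` {1..k} \<subseteq> P"
  proof (intro image_subsetI)
    fix i assume i: "i \<in> {1..k}"
    have "0 < 2 * R / \<eta>" using assms(4,5) by simp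
    then have N0: "0 \<le> N" unfolding N_def by linarith
    have "\<lfloor>blinfun_apply (\<xi> V) (u k i) * (2 / \<eta>)\<rfloor> \<in> {- N - 1..N}" if "V \<inter> K \<noteq> {}" for V
    proof -
      have "\<bar>blinfun_apply (\<xi> V) (u k i)\<bar> \<le> R"
        using cball[of "\<xi> V" "u k i"] \<xi>[OF that] K(2) u[of i k] i by fastforce
      then have "\<bar>blinfun_apply (\<xi> V) (u k i)\<bar> * (2 / \<eta>) \<le> R * (2 / \<eta>)"
        using assms(4) by (intro mult_right_mono) auto
      then have "\<bar>blinfun_apply (\<xi> V) (u k i) * (2 / \<eta>)\<bar> \<le> 2 * R / \<eta>"
        using assms(4) by (simp add: abs_mult mult.commute)
      then show ?thesis unfolding N_def atLeastAtMost_iff by linarith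
    qed
    then show "box k i \<in> P" unfolding box_def P_def using N0 by auto
  qed
  then have "card (box k ` {1..k}) < card {1..k}"
    using card_mono[OF \<open>finite P\<close>, of "box k ` {1..k}"] by (simp add: k_def)
  then obtain i j where ij: "i \<in> {1..k}" "j \<in> {1..k}" "i \<noteq> j" "box k i = box k j"
    using pigeonhole unfolding inj_on_def by blast
  then obtain \<phi> where \<phi>: "\<phi> \<in> K \<inter> W" "\<eta> \<le> blinfun_apply \<phi> (u k i) - blinfun_apply \<phi> (u k j)"
    using sep[of i k j] by auto
  then obtain V where V: "V \<in> \<F>" "\<phi> \<in> V" using F by blast
  then have VK: "V \<inter> K \<noteq> {}" using \<phi> by blast
  have "\<lfloor>blinfun_apply (\<xi> V) (u k i) * (2 / \<eta>)\<rfloor> = \<lfloor>blinfun_apply (\<xi> V) (u k j) * (2 / \<eta>)\<rfloor>"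
    using fun_cong[OF ij(4), of V] V VK by (simp add: box_def)
  then have "\<bar>blinfun_apply (\<xi> V) (u k i) * (2 / \<eta>) - blinfun_apply (\<xi> V) (u k j) * (2 / \<eta>)\<bar> < 1"
    by linarith
  then have 1: "\<bar>blinfun_apply (\<xi> V) (u k i) - blinfun_apply (\<xi> V) (u k j)\<bar> < \<eta> / 2"
    using assms(4) by (simp add: abs_if field_simps split: if_splits)
  have "bounded (V \<inter> K)" using K(2) bounded_cball bounded_subset by blast
  then have "dist \<phi> (\<xi> V) \<le> diameter (V \<inter> K)"
    using diameter_bounded_bound \<xi>[OF VK] V \<phi> by blast
  also have "\<dots> < ?\<epsilon>" using V F by blast
  finally have 2: "norm (\<phi> - \<xi> V) < ?\<epsilon>" by (simp add: dist_norm)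
  \<comment> \<open>The constant \<open>\<eta> / (4 * R)\<close> enters here: times
    \<open>2 * R\<close> it is \<open>\<eta> / 2\<close>. Together with the difference below
    \<open>\<eta> / 2\<close> under \<open>\<xi> V\<close>, it leaves \<open>\<phi>\<close> less
    than the required \<open>\<eta>\<close>.\<close>
  have "norm (u k i - u k j) \<le> R + R"
    using norm_triangle_ineq4[of "u k i" "u k j"] u[of i k] u[of j k] ij by force
  then have "norm (\<phi> - \<xi> V) * norm (u k i - u k j) \<le> ?\<epsilon> * (R + R)"
    using 2 assms(4,5) by (intro mult_mono) auto
  then have "\<bar>(\<phi> - \<xi> V) (u k i - u k j)\<bar> \<le> ?\<epsilon> * (R + R)"
    using norm_blinfun[of "\<phi> - \<xi> V" "u k i - u k j"] by simp
  also have "\<dots> = \<eta> / 2" using assms(5) by (simp add: field_simps)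
  finally have "\<bar>(\<phi> (u k i) - \<phi> (u k j)) - (\<xi> V (u k i) - \<xi> V (u k j))\<bar> \<le> \<eta> / 2"
    by (simp add: blinfun.diff_left blinfun.diff_right algebra_simps)
  then show False using 1 \<phi>(2) by linarith
qed

text \<open>The finite intersection property in the compact ball: the sets decrease, so a finite
  subfamily is controlled by its largest index.\<close>

lemma ex_in_INT_weak_star:
  fixes K :: "nat \<Rightarrow> ('a::real_normed_vector \<Rightarrow>\<^sub>L real) set"
  assumes K: "\<And>k. k \<in> I \<Longrightarrow> closedin weak_star (K k)" "\<And>k. k \<in> I \<Longrightarrow> K k \<subseteq> cball 0 1"
    and W: "closedin weak_star W"
    and mono: "\<And>k l. k \<in> I \<Longrightarrow> l \<in> I \<Longrightarrow> k \<le> l \<Longrightarrow> K l \<subseteq> K k"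
    and ne: "\<And>k. k \<in> I \<Longrightarrow> K k \<inter> W \<noteq> {}" and "I \<noteq> {}"
  shows "(\<Inter>k\<in>I. K k) \<inter> W \<noteq> {}"
proof -
  have "cball 0 1 \<inter> \<Inter>((\<lambda>k. K k \<inter> W) ` I) \<noteq> {}"
  proof (rule compactin_fip[THEN iffD1, OF banach_alaoglu, THEN conjunct2, rule_format], intro conjI ballI allI impI)
    show "closedin weak_star C" if "C \<in> (\<lambda>k. K k \<inter> W) ` I" for C
      using that K(1) W by blast
    fix \<F> assume F: "finite \<F> \<and> \<F> \<subseteq> (\<lambda>k. K k \<inter> W) ` I"
    then obtain J where J: "finite J" "J \<subseteq> I" "\<F> = (\<lambda>k. K k \<inter> W) ` J"
      using finite_subset_image by metis
    \<comment> \<open>An element of \<open>I\<close> is added so that \<open>Max\<close> is taken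
      over a nonempty set even if \<open>J\<close> is empty.\<close>
    define J' where "J' = insert (SOME i. i \<in> I) J"
    have J': "finite J'" "J' \<noteq> {}" "J' \<subseteq> I" "J \<subseteq> J'"
      using J assms(6) some_in_eq unfolding J'_def by auto
    then have m: "Max J' \<in> I" using Max_in by blast
    then obtain \<phi> where \<phi>: "\<phi> \<in> K (Max J') \<inter> W" using ne by blast
    have "\<phi> \<in> K k" if "k \<in> J" for k
      using mono[of k "Max J'"] that J' m \<phi> Max_ge[of J' k] by blast
    then show "cball 0 1 \<inter> \<Inter>\<F> \<noteq> {}" using \<phi> J K(2)[OF m] by blast
  qed
  then show ?thesis using assms(6) by blast
qed

section \<open>Multiples of the index\<close>

text \<open>The map taking \<open>\<psi>\<close> to half of \<open>\<psi> - \<phi>\<close> sends the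
  ball into itself and the surviving \<open>\<phi>\<close> to 0.\<close>

lemma zero_in_szlenk_iter:
  assumes "szlenk_iter \<epsilon> b \<noteq> ({} :: ('x::banach \<Rightarrow>\<^sub>L real) set)"
  shows "(0 :: 'x \<Rightarrow>\<^sub>L real) \<in> szlenk_iter (\<epsilon> / 2) b"
proof -
  obtain \<phi> :: "'x \<Rightarrow>\<^sub>L real" where \<phi>: "\<phi> \<in> szlenk_iter \<epsilon> b" using assms by blast
  then have 1: "norm \<phi> \<le> 1" using szlenk_iter_subset by fastforce
  have "(\<lambda>\<psi>. (1/2) *\<^sub>R \<psi> + (- (1/2) *\<^sub>R \<phi>)) ` cball 0 1 \<subseteq> cball 0 1"
  proof (rule image_subsetI)
    fix \<psi> :: "'x \<Rightarrow>\<^sub>L real" assume "\<psi> \<in> cball 0 1"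
    then show "(1/2) *\<^sub>R \<psi> + (- (1/2) *\<^sub>R \<phi>) \<in> cball 0 1"
      using 1 norm_triangle_ineq[of "(1/2) *\<^sub>R \<psi>" "- (1/2) *\<^sub>R \<phi>"] by simp
  qed
  then have "(1/2) *\<^sub>R \<phi> + (- (1/2) *\<^sub>R \<phi>) \<in> iterate (szlenk_deriv (1/2 * \<epsilon>)) (cball 0 1) b"
    using \<phi> unfolding szlenk_iter_def by (intro iterate_szlenk_deriv_affine) auto
  then show ?thesis by (simp add: szlenk_iter_def)
qed

text \<open>Translating a half-size copy of the ball to any centre of norm at most 1/2 shows that
  the whole half ball survives \<open>b\<close> steps for \<open>\<epsilon> / 2\<close>. This half
  ball is itself a copy of the unit ball, and its centre survives another \<open>c\<close>
  steps.\<close>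

lemma zero_in_szlenk_iter_oadd:
  fixes b c :: "('x::banach \<Rightarrow>\<^sub>L real) ordinal"
  assumes "(0 :: 'x \<Rightarrow>\<^sub>L real) \<in> szlenk_iter \<epsilon> b" "(0 :: 'x \<Rightarrow>\<^sub>L real) \<in> szlenk_iter \<epsilon> c"
    and "countable_ordinal c"
  shows "(0 :: 'x \<Rightarrow>\<^sub>L real) \<in> szlenk_iter (\<epsilon> / 2) (oadd b c)"
proof -
  let ?D = "szlenk_deriv (1/2 * \<epsilon>) :: ('x \<Rightarrow>\<^sub>L real) set \<Rightarrow> _"
  have half: "cball 0 (1/2) \<subseteq> iterate ?D (cball 0 1) b"
  proof
    fix \<phi> :: "'x \<Rightarrow>\<^sub>L real" assume \<phi>: "\<phi> \<in> cball 0 (1/2)"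
    have "(\<lambda>\<psi>. (1/2) *\<^sub>R \<psi> + \<phi>) ` cball 0 1 \<subseteq> cball 0 1"
    proof (rule image_subsetI)
      fix \<psi> :: "'x \<Rightarrow>\<^sub>L real" assume "\<psi> \<in> cball 0 1"
      then show "(1/2) *\<^sub>R \<psi> + \<phi> \<in> cball 0 1"
        using \<phi> norm_triangle_ineq[of "(1/2) *\<^sub>R \<psi>" \<phi>] by simp
    qed
    then have "(1/2) *\<^sub>R 0 + \<phi> \<in> iterate ?D (cball 0 1) b"
      using assms(1) unfolding szlenk_iter_def by (intro iterate_szlenk_deriv_affine) auto
    then show "\<phi> \<in> iterate ?D (cball 0 1) b" by simp
  qed
  have "(\<lambda>\<psi>. (1/2) *\<^sub>R \<psi> + 0) ` cball (0 :: 'x \<Rightarrow>\<^sub>L real) 1 \<subseteq> iterate ?D (cball 0 1) b"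
    using half by (auto simp: subset_iff)
  moreover have "iterate ?D (cball 0 1) b \<subseteq> cball 0 1"
    using szlenk_iter_subset[of "1/2 * \<epsilon>" b] unfolding szlenk_iter_def .
  ultimately have "(1/2) *\<^sub>R 0 + 0 \<in> iterate ?D (iterate ?D (cball 0 1) b) c"
    using assms(2) unfolding szlenk_iter_def
    by (intro iterate_szlenk_deriv_affine) (auto intro: bounded_subset)
  also have "\<dots> \<subseteq> iterate ?D (cball 0 1) (oadd b c)"
  proof (rule iterate_oadd_subset[OF szlenk_deriv_subset _ assms(3)])
    show "?D G \<subseteq> ?D H" if "G \<subseteq> H" "H \<subseteq> cball 0 1" for G H
      using that by (intro szlenk_deriv_mono bounded_subset[OF bounded_cball])
  qed
  finally show ?thesis by (simp add: szlenk_iter_def)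
qed

lemma szlenk_deriv_antimono_eps: "\<delta> \<le> \<epsilon> \<Longrightarrow> szlenk_deriv \<epsilon> F \<subseteq> szlenk_deriv \<delta> F"
  by (force simp: mem_szlenk_deriv)

lemma szlenk_iter_antimono_eps:
  assumes "\<delta> \<le> \<epsilon>" shows "szlenk_iter \<epsilon> b \<subseteq> szlenk_iter \<delta> b"
  unfolding szlenk_iter_def
proof (induction b rule: ordinal_induct)
  case (suc b)
  have "bounded (iterate (szlenk_deriv \<delta>) (cball 0 1) b)"
    using iterate_szlenk_deriv_subset by (rule bounded_subset[OF bounded_cball])
  then show ?case
    using szlenk_deriv_mono[OF suc] szlenk_deriv_antimono_eps[OF assms] unfolding iterate_osuc by blast
qed (auto simp: iterate_ozero iterate_limit)

text \<open>Each further summand halves the admissible constant, so \<open>\<delta>\<close> depends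
  on \<open>n\<close>. This is harmless because the index takes the supremum over all positive
  constants.\<close>

lemma zero_in_szlenk_iter_omult:
  fixes b :: "('x::banach \<Rightarrow>\<^sub>L real) ordinal"
  assumes "(0 :: 'x \<Rightarrow>\<^sub>L real) \<in> szlenk_iter \<epsilon> b" "countable_ordinal b" "\<epsilon> > 0"
  shows "\<exists>\<delta>>0. (0 :: 'x \<Rightarrow>\<^sub>L real) \<in> szlenk_iter \<delta> (omult b (ofin n))"
proof (induction n)
  case 0
  then show ?case using assms(3) by (auto simp: ofin_0 omult_ozero szlenk_iter_def iterate_ozero)
next
  case (Suc n)
  then obtain \<delta> where \<delta>: "\<delta> > 0" "(0 :: 'x \<Rightarrow>\<^sub>L real) \<in> szlenk_iter \<delta> (omult b (ofin n))" by blast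
  have "(0 :: 'x \<Rightarrow>\<^sub>L real) \<in> szlenk_iter (min \<delta> \<epsilon> / 2) (oadd (omult b (ofin n)) b)"
    using \<delta>(2) assms(1,2) szlenk_iter_antimono_eps[of "min \<delta> \<epsilon>" \<delta>] szlenk_iter_antimono_eps[of "min \<delta> \<epsilon>" \<epsilon>]
    by (intro zero_in_szlenk_iter_oadd) (auto simp: subset_iff)
  then show ?case
    unfolding ofin_Suc omult_osuc using \<delta>(1) assms(3) by (intro exI[of _ "min \<delta> \<epsilon> / 2"]) simp
qed

section \<open>From nonempty derivatives to the Szlenk index\<close>

text \<open>The index is a \<open>LEAST\<close> among extended ordinals, so a least upper bound has
  to be exhibited. \<open>Minf\<close> bounds nothing here; the least finite bound works if there is
  one, and \<open>Pinf\<close> otherwise.\<close>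

lemma szlenk_eps_le_index: "\<epsilon> > 0 \<Longrightarrow> szlenk_eps TYPE('x::banach) \<epsilon> \<le> szlenk_index TYPE('x)"
proof -
  assume "\<epsilon> > 0"
  let ?P = "\<lambda>s. \<forall>\<epsilon>>0. szlenk_eps TYPE('x) \<epsilon> \<le> s"
  have noMinf: "s \<noteq> Minf" if "?P s" for s
    using that[rule_format, of 1] by (auto simp: szlenk_eps_def split: if_splits)
  have "\<exists>s. ?P s \<and> (\<forall>t. ?P t \<longrightarrow> s \<le> t)"
  proof (cases "\<exists>b. ?P (Fin b)")
    case True
    then have "?P (Fin (LEAST b. ?P (Fin b)))" by (rule LeastI_ex)
    moreover have "Fin (LEAST b. ?P (Fin b)) \<le> t" if "?P t" for t
      using that noMinf[OF that] by (cases t) (auto intro: Least_le)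
    ultimately show ?thesis by blast
  next
    case False
    then have "t = Pinf" if "?P t" for t using that noMinf[OF that] by (cases t) auto
    then show ?thesis by (intro exI[of _ Pinf]) auto
  qed
  then obtain s where "?P s" "\<And>t. ?P t \<Longrightarrow> s \<le> t" by blast
  then have "?P (szlenk_index TYPE('x))"
    unfolding szlenk_index_def by (rule LeastI2_order)
  then show ?thesis using \<open>\<epsilon> > 0\<close> by blast
qed

text \<open>Since the iterates decrease, no iterate before a nonempty one can be empty.\<close>

lemma szlenk_index_ge:
  fixes b :: "('x::banach \<Rightarrow>\<^sub>L real) ordinal"
  assumes "\<epsilon> > 0" "szlenk_iter \<epsilon> b \<noteq> ({} :: ('x \<Rightarrow>\<^sub>L real) set)"
  shows "Fin b \<le> szlenk_index TYPE('x)"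
proof -
  have "Fin b \<le> szlenk_eps TYPE('x) \<epsilon>"
  proof (cases "\<exists>b. szlenk_iter \<epsilon> b = ({} :: ('x \<Rightarrow>\<^sub>L real) set)")
    case True
    then have "szlenk_iter \<epsilon> (LEAST b. szlenk_iter \<epsilon> b = ({} :: ('x \<Rightarrow>\<^sub>L real) set)) = ({} :: ('x \<Rightarrow>\<^sub>L real) set)"
      by (rule LeastI_ex)
    then have "b \<le> (LEAST b. szlenk_iter \<epsilon> b = ({} :: ('x \<Rightarrow>\<^sub>L real) set))"
      using assms(2) szlenk_iter_antimono by (metis linear subset_empty)
    then show ?thesis using True by (simp add: szlenk_eps_def)
  qed (simp add: szlenk_eps_def)
  then show ?thesis using szlenk_eps_le_index[OF assms(1)] by (rule order_trans)
qed

lemma szlenk_index_ge_omult_omega: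
  fixes b :: "('x::banach \<Rightarrow>\<^sub>L real) ordinal"
  assumes "\<epsilon> > 0" "szlenk_iter \<epsilon> b \<noteq> ({} :: ('x \<Rightarrow>\<^sub>L real) set)" "countable_ordinal b"
  shows "Fin (omult b omega) \<le> szlenk_index TYPE('x)"
proof -
  have le: "Fin (omult b (ofin n)) \<le> szlenk_index TYPE('x)" for n
  proof -
    obtain \<delta> where "\<delta> > 0" "(0 :: 'x \<Rightarrow>\<^sub>L real) \<in> szlenk_iter \<delta> (omult b (ofin n))"
      using zero_in_szlenk_iter_omult[OF zero_in_szlenk_iter[OF assms(2)] assms(3)] assms(1) by auto
    then show ?thesis using szlenk_index_ge by blast
  qed
  show ?thesis
  proof (cases "szlenk_index TYPE('x)")
    case (Fin c)
    have "a \<le> c" if a: "a \<in> omult b ` {..<omega}" for a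
    proof -
      obtain n where "a = omult b (ofin n)" using a less_omega_imp_ofin by blast
      then show ?thesis using le[of n] Fin by simp
    qed
    then show ?thesis unfolding Fin omult_limit[OF is_limit_omega] by (simp add: osup_least)
  next
    case Minf
    then show ?thesis using le[of 0] by simp
  qed simp
qed

section \<open>Sup-amalgams\<close>

text \<open>On \<open>Origin\<close> and vertices this is the path metric of a star centred at
  \<open>Origin\<close>, the metric that every space of the construction induces on its common
  part.\<close>

definition base_dist :: "point \<Rightarrow> point \<Rightarrow> real" where
  "base_dist x y = (if x = y then 0 else if x = Origin \<or> y = Origin then 1 else 2)"

text \<open>An invariant of amalgamation. The upper bound 4 keeps suprema finite, and the lower
  bound 1 for distinct points makes the canonical copies of the factors isometric.\<close>

definition admissible :: "point set \<Rightarrow> point mspc \<Rightarrow> bool" where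
  "admissible A N \<longleftrightarrow> A \<subseteq> fst N \<and> (\<forall>x\<in>A. \<forall>y\<in>A. snd N x y = base_dist x y) \<and>
     (\<forall>x\<in>fst N. \<forall>y\<in>fst N. 0 \<le> snd N x y \<and> snd N x y \<le> 4 \<and> (x \<noteq> y \<longrightarrow> 1 \<le> snd N x y))"

lemma admissibleD:
  assumes "admissible A N"
  shows "x \<in> A \<Longrightarrow> x \<in> fst N" "x \<in> A \<Longrightarrow> y \<in> A \<Longrightarrow> snd N x y = base_dist x y"
    "x \<in> fst N \<Longrightarrow> y \<in> fst N \<Longrightarrow> 0 \<le> snd N x y" "x \<in> fst N \<Longrightarrow> y \<in> fst N \<Longrightarrow> snd N x y \<le> 4"
    "x \<in> fst N \<Longrightarrow> y \<in> fst N \<Longrightarrow> x \<noteq> y \<Longrightarrow> 1 \<le> snd N x y"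
  using assms unfolding admissible_def by blast+

lemma admissible_subset: "admissible B N \<Longrightarrow> A \<subseteq> B \<Longrightarrow> admissible A N"
  unfolding admissible_def by blast

text \<open>The canonical copy of the \<open>k\<close>-th factor. Points of \<open>A\<close> stay
  fixed because constant families are identified with their value.\<close>

definition incl :: "point set \<Rightarrow> nat \<Rightarrow> point \<Rightarrow> point" where
  "incl A k y = (if y \<in> A then y else Family (\<lambda>i\<in>{1..}. if i = k then y else Origin))"

context
  fixes A :: "point set" and M :: "nat \<Rightarrow> point mspc"
  assumes Origin_mem: "Origin \<in> A" and no_Family: "\<And>x. Family x \<notin> A"
    and M: "\<And>k. k \<ge> 1 \<Longrightarrow> admissible A (M k)"
begin

text \<open>No point \<open>Family x\<close> lies in \<open>A\<close>, so constant and genuine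
  families cannot be confused and the identification can be undone.\<close>

lemma family_of_point_of_family:
  assumes "x \<in> amalgam_families A M"
  shows "family_of_point A (point_of_family A x) = x"
proof (cases "x 1 \<in> A \<and> (\<forall>i\<ge>1. x i = x 1)")
  case True
  have "x \<in> extensional {1..}" using assms by (auto simp: amalgam_families_def PiE_def)
  moreover have "(\<lambda>i\<in>{1..}. x 1) i = x i" if i: "i \<in> {1..}" for i
  proof -
    have "x i = x 1" using True i by (meson atLeast_iff)
    then show ?thesis using i by simp
  qed
  ultimately have "(\<lambda>i\<in>{1..}. x 1) = x" by (intro extensionalityI[of _ "{1..}"]) auto
  moreover have "point_of_family A x = x 1" unfolding point_of_family_def using True by (rule if_P)
  ultimately show ?thesis using conjunct1[OF True] by (simp only: family_of_point_def if_True)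
next
  case False
  then have "point_of_family A x = Family x" unfolding point_of_family_def by (rule if_not_P)
  then show ?thesis using no_Family by (simp add: family_of_point_def)
qed

lemma family_of_point_incl:
  "i \<ge> 1 \<Longrightarrow> family_of_point A (incl A k y) i = (if i = k \<or> y \<in> A then y else Origin)"
  using no_Family by (auto simp: family_of_point_def incl_def)

lemma incl_mem:
  assumes "k \<ge> 1" "y \<in> fst (M k)"
  shows "incl A k y \<in> fst (sup_amalgam A M)"
proof (cases "y \<in> A")
  case True
  let ?x = "\<lambda>i\<in>{1::nat..}. y"
  have "y \<in> fst (M i)" if "i \<ge> 1" for i using M[OF that] True by (rule admissibleD(1))
  then have "?x \<in> amalgam_families A M" using True by (auto simp: amalgam_families_def)
  moreover have "point_of_family A ?x = incl A k y" using True by (simp add: point_of_family_def incl_def)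
  ultimately show ?thesis unfolding sup_amalgam_def fst_conv by (metis image_eqI)
next
  case False
  let ?x = "\<lambda>i\<in>{1::nat..}. if i = k then y else Origin"
  have "?x \<in> Pi\<^sub>E {1..} (\<lambda>i. fst (M i))"
  proof (rule PiE_I)
    show "?x i \<in> fst (M i)" if "i \<in> {1..}" for i
      using that assms(2) admissibleD(1)[OF M Origin_mem, of i] by simp
  qed simp
  moreover have "\<exists>!i. i \<ge> 1 \<and> ?x i \<notin> A \<and> (\<forall>j\<ge>1. j \<noteq> i \<longrightarrow> ?x j = Origin)"
    using assms(1) False Origin_mem by (intro ex1I[of _ k]) (auto split: if_splits)
  ultimately have "?x \<in> amalgam_families A M" unfolding amalgam_families_def by blast
  moreover have "\<not> (?x 1 \<in> A \<and> (\<forall>i\<ge>1. ?x i = ?x 1))"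
  proof
    assume *: "?x 1 \<in> A \<and> (\<forall>i\<ge>1. ?x i = ?x 1)"
    then have "?x k = ?x 1" using assms(1) by blast
    then show False using * assms(1) False by simp
  qed
  then have "point_of_family A ?x = incl A k y"
    using False unfolding point_of_family_def incl_def by (simp only: if_False)
  ultimately show ?thesis unfolding sup_amalgam_def fst_conv by (metis image_eqI)
qed

text \<open>Coordinates other than \<open>k\<close> contribute no more than coordinate
  \<open>k\<close>. There points outside \<open>A\<close> become \<open>Origin\<close>: two points
  of \<open>A\<close> keep their distance, while other distinct points come within distance 1, and
  their distance in \<open>M k\<close> is at least 1.\<close>

lemma incl_dist:
  assumes k: "k \<ge> 1" and x: "x \<in> fst (M k)" and y: "y \<in> fst (M k)"
  shows "snd (sup_amalgam A M) (incl A k x) (incl A k y) = snd (M k) x y"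
proof -
  let ?g = "\<lambda>i z. if i = k \<or> z \<in> A then z else Origin"
  have "snd (sup_amalgam A M) (incl A k x) (incl A k y) = (SUP i\<in>{1..}. snd (M i) (?g i x) (?g i y))"
    unfolding sup_amalgam_def snd_conv by (intro SUP_cong refl) (simp add: family_of_point_incl)
  also have "\<dots> = snd (M k) x y"
  proof (rule cSup_eq_maximum)
    show "snd (M k) x y \<in> (\<lambda>i. snd (M i) (?g i x) (?g i y)) ` {1..}"
      using k by (intro image_eqI[of _ _ k]) auto
    fix r assume "r \<in> (\<lambda>i. snd (M i) (?g i x) (?g i y)) ` {1..}"
    then obtain i where i: "i \<ge> 1" and r: "r = snd (M i) (?g i x) (?g i y)" by auto
    have gA: "?g i z \<in> A" if "i \<noteq> k" for z using that Origin_mem by simp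
    show "r \<le> snd (M k) x y"
    proof (cases "i = k")
      case False
      then have "r = base_dist (?g i x) (?g i y)"
        unfolding r using admissibleD(2)[OF M[OF i] gA gA] by blast
      moreover consider "x \<in> A" "y \<in> A" | "x \<noteq> y" "x \<notin> A \<or> y \<notin> A" | "x = y" "x \<notin> A" by blast
      then have "base_dist (?g i x) (?g i y) \<le> snd (M k) x y"
      proof cases
        case 1
        then show ?thesis using admissibleD(2)[OF M[OF k] 1] by simp
      next
        case 2
        have "base_dist (?g i x) (?g i y) \<le> 1" using 2 False by (auto simp: base_dist_def)
        then show ?thesis using admissibleD(5)[OF M[OF k] x y 2(1)] by simp
      next
        case 3
        then show ?thesis using admissibleD(3)[OF M[OF k] x y] by (simp add: base_dist_def)
      qed
      ultimately show ?thesis by simp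
    qed (simp add: r)
  qed
  finally show ?thesis .
qed

text \<open>Distances within \<open>A\<close> are read off in the first factor. For other points the
  bounds pass through the supremum, and distinct families differ in some coordinate.\<close>

lemma admissible_sup_amalgam: "admissible A (sup_amalgam A M)"
  unfolding admissible_def
proof (intro conjI ballI subsetI)
  have mem: "x \<in> fst (M 1)" "incl A 1 x = x" if "x \<in> A" for x
    using that M[of 1] admissibleD(1) by (auto simp: incl_def)
  show "x \<in> fst (sup_amalgam A M)" if "x \<in> A" for x
    using incl_mem[of 1 x] mem[OF that] by simp
  show "snd (sup_amalgam A M) x y = base_dist x y" if "x \<in> A" "y \<in> A" for x y
    using incl_dist[of 1 x y] mem[OF that(1)] mem[OF that(2)] admissibleD(2)[OF M that] by simp
  fix p q assume "p \<in> fst (sup_amalgam A M)" "q \<in> fst (sup_amalgam A M)"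
  then obtain x y where x: "x \<in> amalgam_families A M" "p = point_of_family A x"
    and y: "y \<in> amalgam_families A M" "q = point_of_family A y"
    unfolding sup_amalgam_def by auto
  let ?d = "\<lambda>i. snd (M i) (x i) (y i)"
  have d: "snd (sup_amalgam A M) p q = (SUP i\<in>{1..}. ?d i)"
    unfolding sup_amalgam_def snd_conv x(2) y(2) family_of_point_of_family[OF x(1)]
      family_of_point_of_family[OF y(1)] ..
  have xy: "x \<in> Pi\<^sub>E {1..} (\<lambda>i. fst (M i))" "y \<in> Pi\<^sub>E {1..} (\<lambda>i. fst (M i))"
    using x y by (auto simp: amalgam_families_def)
  then have mem: "x i \<in> fst (M i)" "y i \<in> fst (M i)" if "i \<ge> 1" for i
    using that by (auto dest: PiE_mem)
  have bounds: "0 \<le> ?d i" "?d i \<le> 4" if "i \<ge> 1" for i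
    using admissibleD(3,4)[OF M[OF that] mem[OF that]] .
  then have bdd: "bdd_above (?d ` {1..})" by (intro bdd_aboveI2[of _ _ 4]) auto
  have ge: "?d i \<le> snd (sup_amalgam A M) p q" if "i \<ge> 1" for i
    unfolding d using bdd that by (intro cSUP_upper) auto
  show "0 \<le> snd (sup_amalgam A M) p q" using ge[of 1] bounds(1)[of 1] by simp
  show "snd (sup_amalgam A M) p q \<le> 4" unfolding d using bounds by (intro cSUP_least) auto
  show "p \<noteq> q \<longrightarrow> 1 \<le> snd (sup_amalgam A M) p q"
  proof
    assume "p \<noteq> q"
    then have "x \<noteq> y" using x y by blast
    then obtain i where i: "i \<ge> 1" "x i \<noteq> y i" using PiE_ext[OF xy] by auto
    then show "1 \<le> snd (sup_amalgam A M) p q"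
      using ge[OF i(1)] admissibleD(5)[OF M[OF i(1)] mem[OF i(1)] i(2)] by simp
  qed
qed

lemma bilipschitz_with_incl:
  assumes "bilipschitz_with (sup_amalgam A M) f C1 C2" "k \<ge> 1"
  shows "bilipschitz_with (M k) (f \<circ> incl A k) C1 C2"
  unfolding bilipschitz_with_def
proof (intro conjI ballI)
  show "C1 > 0" "C2 > 0" using assms by (auto simp: bilipschitz_with_def)
  fix x y assume xy: "x \<in> fst (M k)" "y \<in> fst (M k)"
  show "C1 * snd (M k) x y \<le> dist ((f \<circ> incl A k) x) ((f \<circ> incl A k) y)"
    "dist ((f \<circ> incl A k) x) ((f \<circ> incl A k) y) \<le> C2 * snd (M k) x y"
    using assms incl_mem[OF assms(2) xy(1)] incl_mem[OF assms(2) xy(2)]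
    unfolding bilipschitz_with_def comp_def incl_dist[OF assms(2) xy, symmetric] by auto
qed

end

section \<open>Three-level graphs\<close>

lemma graph_edges_iff:
  "(Origin, y) \<in> graph_edges Cs \<longleftrightarrow> (\<exists>c\<in>\<Union>(set Cs). y = Vertex c)"
  "(x, Origin) \<in> graph_edges Cs \<longleftrightarrow> (\<exists>c\<in>\<Union>(set Cs). x = Vertex c)"
  "(Vertex a, Face S) \<in> graph_edges Cs \<longleftrightarrow> a \<in> \<Union>(set Cs) \<and> S \<in> faces Cs \<and> a \<in> S"
  "(Face S, Vertex a) \<in> graph_edges Cs \<longleftrightarrow> a \<in> \<Union>(set Cs) \<and> S \<in> faces Cs \<and> a \<in> S"
  "(Vertex a, Vertex b) \<notin> graph_edges Cs"
  unfolding graph_edges_def Let_def Un_iff converse_iff mem_Collect_eq by blast+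

lemma graph_edges_cases:
  assumes "(x, y) \<in> graph_edges Cs"
  obtains a where "a \<in> \<Union>(set Cs)" "x = Origin" "y = Vertex a"
  | a where "a \<in> \<Union>(set Cs)" "x = Vertex a" "y = Origin"
  | a S where "S \<in> faces Cs" "a \<in> S" "x = Vertex a" "y = Face S"
  | a S where "S \<in> faces Cs" "a \<in> S" "x = Face S" "y = Vertex a"
  using assms unfolding graph_edges_def Let_def Un_iff converse_iff mem_Collect_eq by blast

lemma faces_subset: "S \<in> faces Cs \<Longrightarrow> S \<subseteq> \<Union>(set Cs)"
proof -
  assume "S \<in> faces Cs"
  then obtain cs where cs: "S = set cs" "list_all2 (\<in>) cs Cs" by (auto simp: faces_def)
  have "set cs \<subseteq> \<Union>(set Cs)" using cs(2) by (induction rule: list_all2_induct) auto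
  then show ?thesis using cs by simp
qed

lemma faces_nonempty: "S \<in> faces Cs \<Longrightarrow> Cs \<noteq> [] \<Longrightarrow> S \<noteq> {}"
  by (auto simp: faces_def)

lemma insert_mem_faces:
  assumes "S \<in> faces Cs" "c \<in> C" shows "insert c S \<in> faces (Cs @ [C])"
proof -
  obtain cs where cs: "S = set cs" "list_all2 (\<in>) cs Cs" using assms(1) by (auto simp: faces_def)
  then have "list_all2 (\<in>) (cs @ [c]) (Cs @ [C])" using assms(2) by (intro list_all2_appendI) auto
  moreover have "insert c S = set (cs @ [c])" using cs by simp
  ultimately show ?thesis unfolding faces_def by blast
qed

context
  fixes Cs :: "(nat \<times> nat) set list"
  assumes Cs: "Cs \<noteq> []"
begin

text \<open>A face is nonempty because there is at least one level, and any of its vertices is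
  joined to \<open>Origin\<close>.\<close>

lemma path_to_Origin:
  assumes "x \<in> graph_points Cs"
  obtains k where "k \<le> 2" "(x, Origin) \<in> graph_edges Cs ^^ k" "(Origin, x) \<in> graph_edges Cs ^^ k"
proof -
  consider "x = Origin" | c where "c \<in> \<Union>(set Cs)" "x = Vertex c" | S where "S \<in> faces Cs" "x = Face S"
    using assms by (auto simp: graph_points_def)
  then show ?thesis
  proof cases
    case 1
    then show ?thesis using that[of 0] by simp
  next
    case 2
    then show ?thesis using that[of 1] by (simp add: graph_edges_iff)
  next
    case 3
    then obtain a where a: "a \<in> S" using faces_nonempty Cs by blast
    then have "a \<in> \<Union>(set Cs)" using faces_subset 3 by blast
    then have "(x, Vertex a) \<in> graph_edges Cs" "(Vertex a, Origin) \<in> graph_edges Cs"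
      "(Vertex a, x) \<in> graph_edges Cs" "(Origin, Vertex a) \<in> graph_edges Cs"
      using 3 a by (simp_all add: graph_edges_iff)
    then have "(x, Origin) \<in> graph_edges Cs ^^ 2" "(Origin, x) \<in> graph_edges Cs ^^ 2"
      unfolding numeral_2_eq_2 by auto
    then show ?thesis using that[of 2] by simp
  qed
qed

text \<open>Connectedness makes the \<open>LEAST\<close> in the metric an attained path length; the
  route through \<open>Origin\<close> bounds the diameter by 4.\<close>

lemma path_in_graph:
  assumes "x \<in> graph_points Cs" "y \<in> graph_points Cs"
  obtains k where "k \<le> 4" "(x, y) \<in> graph_edges Cs ^^ k"
proof -
  obtain k l where kl: "k \<le> 2" "l \<le> 2" "(x, Origin) \<in> graph_edges Cs ^^ k" "(Origin, y) \<in> graph_edges Cs ^^ l"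
    using path_to_Origin assms by metis
  then have "(x, y) \<in> graph_edges Cs ^^ (k + l)" unfolding relpow_add by blast
  then show ?thesis using that[of "k + l"] kl by simp
qed

lemma admissible_level_graph:
  "admissible ({Origin} \<union> Vertex ` \<Union>(set Cs)) (level_graph Cs)"
  unfolding admissible_def level_graph_def fst_conv snd_conv
proof (intro conjI ballI)
  let ?E = "graph_edges Cs"
  let ?d = "\<lambda>x y. LEAST n. (x, y) \<in> ?E ^^ n"
  show "{Origin} \<union> Vertex ` \<Union>(set Cs) \<subseteq> graph_points Cs" by (auto simp: graph_points_def)
  fix x y
  {
    assume xy: "x \<in> {Origin} \<union> Vertex ` \<Union>(set Cs)" "y \<in> {Origin} \<union> Vertex ` \<Union>(set Cs)"
    then consider "x = y" | "x \<noteq> y" "x = Origin \<or> y = Origin"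
      | a b where "a \<in> \<Union>(set Cs)" "b \<in> \<Union>(set Cs)" "a \<noteq> b" "x = Vertex a" "y = Vertex b" by blast
    then show "real (?d x y) = base_dist x y"
    proof cases
      case 1
      then have "?d x y = 0" by (intro Least_equality) auto
      then show ?thesis using 1 by (simp add: base_dist_def)
    next
      case 2
      then have "(x, y) \<in> ?E ^^ 1" using xy by (auto simp: graph_edges_iff)
      moreover have "1 \<le> n" if "(x, y) \<in> ?E ^^ n" for n using that 2(1) by (cases n) auto
      ultimately have "?d x y = 1" by (intro Least_equality)
      then show ?thesis using 2 by (simp add: base_dist_def)
    next
      case 3
      then have "(x, Origin) \<in> ?E" "(Origin, y) \<in> ?E" by (simp_all add: graph_edges_iff)
      then have "(x, y) \<in> ?E ^^ 2" unfolding numeral_2_eq_2 by auto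
      moreover have "2 \<le> n" if n: "(x, y) \<in> ?E ^^ n" for n
      proof (rule ccontr)
        assume "\<not> 2 \<le> n"
        then have "n = 0 \<or> n = 1" by linarith
        then show False using n 3 by (auto simp: graph_edges_iff)
      qed
      ultimately have "?d x y = 2" by (intro Least_equality)
      then show ?thesis using 3 by (simp add: base_dist_def)
    qed
  }
  assume xy: "x \<in> graph_points Cs" "y \<in> graph_points Cs"
  show "0 \<le> real (?d x y)" by simp
  obtain k where k: "k \<le> 4" "(x, y) \<in> ?E ^^ k" using path_in_graph[OF xy] .
  then have "?d x y \<le> k" by (intro Least_le)
  then show "real (?d x y) \<le> 4" using k by simp
  show "x \<noteq> y \<longrightarrow> 1 \<le> real (?d x y)"
  proof
    assume "x \<noteq> y"
    moreover have "(x, y) \<in> ?E ^^ ?d x y" using k(2) by (rule LeastI)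
    ultimately show "1 \<le> real (?d x y)" by (cases "?d x y") auto
  qed
qed

lemma level_graph_dist_Vertex_Face:
  assumes "S \<in> faces Cs" "a \<in> S"
  shows "snd (level_graph Cs) (Face S) (Vertex a) \<le> 1" "snd (level_graph Cs) (Vertex a) (Face S) \<le> 1"
proof -
  have "a \<in> \<Union>(set Cs)" using faces_subset assms by blast
  then have "(Face S, Vertex a) \<in> graph_edges Cs ^^ 1" "(Vertex a, Face S) \<in> graph_edges Cs ^^ 1"
    using assms by (simp_all add: graph_edges_iff)
  then have "(LEAST n. (Face S, Vertex a) \<in> graph_edges Cs ^^ n) \<le> 1"
    "(LEAST n. (Vertex a, Face S) \<in> graph_edges Cs ^^ n) \<le> 1" by (auto intro: Least_le)
  then show "snd (level_graph Cs) (Face S) (Vertex a) \<le> 1" "snd (level_graph Cs) (Vertex a) (Face S) \<le> 1"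
    unfolding level_graph_def by simp_all
qed

lemma level_graph_dist_Face_Face:
  assumes S: "S \<in> faces Cs" and S': "S' \<in> faces Cs" and "S \<inter> S' = {}"
  shows "4 \<le> snd (level_graph Cs) (Face S) (Face S')"
proof -
  \<comment> \<open>The distance to \<open>Face S\<close> in the graph; only its Lipschitz property is needed.\<close>
  define g :: "point \<Rightarrow> nat" where
    "g x = (case x of Origin \<Rightarrow> 2 | Vertex a \<Rightarrow> if a \<in> S then 1 else 3
      | Face U \<Rightarrow> if U = S then 0 else if U \<inter> S = {} then 4 else 2 | Family _ \<Rightarrow> 0)" for x
  have step: "g y \<le> Suc (g x)" if "(x, y) \<in> graph_edges Cs" for x y
    using that by (cases rule: graph_edges_cases) (auto simp: g_def)
  have "g y \<le> g x + n" if "(x, y) \<in> graph_edges Cs ^^ n" for x y n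
    using that
  proof (induction n arbitrary: y)
    case (Suc n)
    then obtain z where "(x, z) \<in> graph_edges Cs ^^ n" "(z, y) \<in> graph_edges Cs" by auto
    then show ?case using Suc.IH[of z] step[of z y] by simp
  qed simp
  \<comment> \<open>Nonemptiness of \<open>S\<close> makes the disjoint face \<open>S'\<close>
    different from \<open>S\<close>, which gives the value 4 rather than 0.\<close>
  moreover have "g (Face S) = 0" "g (Face S') = 4"
    using assms faces_nonempty[OF S Cs] by (auto simp: g_def)
  ultimately have le: "4 \<le> n" if "(Face S, Face S') \<in> graph_edges Cs ^^ n" for n
    using that by fastforce
  have "Face S \<in> graph_points Cs" "Face S' \<in> graph_points Cs" using S S' by (auto simp: graph_points_def)
  then obtain k where "(Face S, Face S') \<in> graph_edges Cs ^^ k" using path_in_graph by metis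
  then have "(Face S, Face S') \<in> graph_edges Cs ^^ (LEAST n. (Face S, Face S') \<in> graph_edges Cs ^^ n)"
    by (rule LeastI)
  then show ?thesis using le unfolding level_graph_def by simp
qed

end

section \<open>Adding one level to a face\<close>

lemma levels_append: "levels (p @ [k]) = levels p @ [segment (Suc (length p)) k]"
  by (auto simp: levels_def nth_append intro!: map_cong)

lemma levels_nonempty: "levels p \<noteq> []" by (simp add: levels_def)

lemma fst_le_length: "c \<in> \<Union>(set (levels p)) \<Longrightarrow> fst c \<le> length p"
  by (auto simp: levels_def segment_def)

lemma common_part_append: "common_part p \<subseteq> common_part (p @ [k])"
  by (auto simp: common_part_def levels_append)

lemma Origin_mem_common_part: "Origin \<in> common_part p"
  and Family_notin_common_part: "Family x \<notin> common_part p"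
  and Vertex_mem_common_part: "Vertex a \<in> common_part p \<longleftrightarrow> a \<in> \<Union>(set (levels p))"
  by (auto simp: common_part_def)

lemma insert_mem_faces_levels:
  assumes "S \<in> faces (levels p)" "1 \<le> i" "i \<le> k"
  shows "insert (Suc (length p), i) S \<in> faces (levels (p @ [k]))"
  unfolding levels_append using assms by (intro insert_mem_faces) (auto simp: segment_def)

text \<open>The added vertices have first coordinate \<open>Suc (length p)\<close>, which exceeds
  the first coordinates of all vertices in the levels of \<open>p\<close>.\<close>

lemma insert_disjoint_faces_levels:
  assumes "S \<in> faces (levels p)" "S' \<in> faces (levels p)" "S \<inter> S' = {}" "i \<noteq> j"
  shows "insert (Suc (length p), i) S \<inter> insert (Suc (length p), j) S' = {}"
proof -
  have "(Suc (length p), l) \<notin> S" "(Suc (length p), l) \<notin> S'" for l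
    using faces_subset[OF assms(1)] faces_subset[OF assms(2)] fst_le_length[of "(Suc (length p), l)" p] by auto
  then show ?thesis using assms by auto
qed

lemma admissible_level_graph_levels: "admissible (common_part p) (level_graph (levels p))"
  unfolding common_part_def by (rule admissible_level_graph[OF levels_nonempty])

section \<open>Trees and stages\<close>

text \<open>The empty sequence is left out because the trees consist of nonempty sequences.\<close>

definition subtree :: "nat list \<Rightarrow> nat list set \<Rightarrow> nat list set" where
  "subtree p T = {m. m \<noteq> [] \<and> p @ m \<in> T}"

lemma subtree_append: "subtree (p @ q) T = subtree q (subtree p T)"
  by (auto simp: subtree_def)

lemma max_nodes_subtree: "m \<noteq> [] \<Longrightarrow> m \<in> max_nodes (subtree p T) \<longleftrightarrow> p @ m \<in> max_nodes T"
  by (auto simp: subtree_def max_nodes_def)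

lemma tree_deriv_subset: "tree_deriv T \<subseteq> T"
  by (auto simp: tree_deriv_def)

text \<open>Whether a node below \<open>p\<close> survives depends on its siblings and their
  extensions only, and these all lie below \<open>p\<close>.\<close>

lemma subtree_tree_deriv: "subtree p (tree_deriv T) = tree_deriv (subtree p T)"
proof -
  have nonempty: "p @ m \<in> tree_deriv T \<longleftrightarrow> m \<in> tree_deriv (subtree p T)" if "m \<noteq> []" for m
  proof -
    have "butlast (p @ m) @ [k] = p @ (butlast m @ [k])" for k using that by (simp add: butlast_append)
    moreover have "p @ (butlast m @ [k]) \<in> T \<longleftrightarrow> butlast m @ [k] \<in> subtree p T" for k
      by (simp add: subtree_def)
    ultimately show ?thesis
      unfolding tree_deriv_def using max_nodes_subtree[of "butlast m @ [_]" p T] that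
      by (simp add: subtree_def)
  qed
  have empty: "[] \<notin> tree_deriv (subtree p T)" by (auto simp: tree_deriv_def subtree_def)
  have "m \<in> subtree p (tree_deriv T) \<longleftrightarrow> m \<in> tree_deriv (subtree p T)" for m
  proof (cases "m = []")
    case True
    then show ?thesis using empty by (simp add: subtree_def[of p "tree_deriv T"])
  next
    case False
    then show ?thesis using nonempty[OF False] by (simp add: subtree_def[of p "tree_deriv T"])
  qed
  then show ?thesis by (rule set_eqI)
qed

lemma subtree_iterate:
  fixes b :: "'o::{wellorder,no_top}"
  shows "subtree p (iterate tree_deriv T b) = iterate tree_deriv (subtree p T) b"
proof (induction b rule: ordinal_induct)
  case (limit b)
  have "subtree p (\<Inter>c<b. iterate tree_deriv T c) = (\<Inter>c<b. subtree p (iterate tree_deriv T c))"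
    using ozero_less_limit[OF limit(1)] by (auto simp: subtree_def)
  then show ?case using limit by (simp add: iterate_limit)
qed (simp_all add: iterate_ozero iterate_osuc subtree_tree_deriv)

text \<open>If the tree below a node is \<open>tree_suc fs \<gamma>\<close> with nonzero
  \<open>\<gamma>\<close>, the tree below its \<open>k\<close>-th child is the one for this ordinal.
  Successor and limit clauses are thus treated together.\<close>

definition child_rank :: "('o::wellorder \<Rightarrow> nat \<Rightarrow> 'o) \<Rightarrow> 'o \<Rightarrow> nat \<Rightarrow> 'o" where
  "child_rank fs \<gamma> k = (if is_osuc \<gamma> then opred \<gamma> else fs \<gamma> k)"

text \<open>For a node \<open>p\<close> whose subtree has rank \<open>\<gamma>\<close> this is the
  amalgam formed just after stage \<open>\<gamma>\<close>; for \<open>p = []\<close> it is the space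
  \<open>M_suc\<close>.\<close>

definition node_space :: "nat list set \<Rightarrow> 'o::wellorder \<Rightarrow> nat list \<Rightarrow> point mspc" where
  "node_space T \<gamma> p = sup_amalgam (common_part p) (\<lambda>k. stage T \<gamma> (p @ [k]))"

context
  fixes fs :: "'o::{wellorder,no_top} \<Rightarrow> nat \<Rightarrow> 'o"
  assumes fs: "fundamental_sequences fs"
begin

lemma child_rank_osuc: "child_rank fs (osuc \<gamma>) k = \<gamma>"
  by (simp add: child_rank_def is_osuc_def opred_osuc) blast

lemma child_rank_limit: "is_limit \<gamma> \<Longrightarrow> child_rank fs \<gamma> k = fs \<gamma> k"
  by (simp add: child_rank_def is_limit_def)

lemma increases_to_fs: "is_limit \<gamma> \<Longrightarrow> countable_ordinal \<gamma> \<Longrightarrow> increases_to (fs \<gamma>) \<gamma>"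
  using fs by (simp add: fundamental_sequences_def)

lemma child_rank_less:
  assumes "\<gamma> \<noteq> ozero" "countable_ordinal \<gamma>" "k \<ge> 1" shows "child_rank fs \<gamma> k < \<gamma>"
proof (cases \<gamma> rule: ordinal_cases)
  case (suc \<delta>)
  then show ?thesis by (simp add: child_rank_osuc osuc_greater)
next
  case limit
  then show ?thesis
    using increases_to_fs[OF limit assms(2)] assms by (simp add: child_rank_limit increases_to_def)
qed (use assms in simp)

lemma child_rank_cofinal:
  assumes "countable_ordinal \<gamma>" "\<beta> < \<gamma>" shows "\<exists>k\<ge>1. \<beta> \<le> child_rank fs \<gamma> k"
proof (cases \<gamma> rule: ordinal_cases)
  case zero
  then show ?thesis using assms(2) ozero_le[of \<beta>] by simp
next
  case (suc \<delta>)
  then show ?thesis using assms(2) by (auto simp: child_rank_osuc less_osuc_iff)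
next
  case limit
  then show ?thesis
    using increases_to_fs[OF limit assms(1)] assms(2) less_imp_le
    by (simp add: child_rank_limit increases_to_def) blast
qed

lemma tree_suc_ozero: "tree_suc fs ozero = {[n] | n. n \<ge> 1}"
  by (simp add: tree_suc_def trec_ozero)

lemma tree_suc_unfold:
  assumes "\<gamma> \<noteq> ozero" "countable_ordinal \<gamma>"
  shows "tree_suc fs \<gamma> = {[n] | n. n \<ge> 1} \<union> (\<Union>n\<in>{1..}. (#) n ` tree_suc fs (child_rank fs \<gamma> n))"
proof (cases \<gamma> rule: ordinal_cases)
  case (suc \<delta>)
  then show ?thesis unfolding suc child_rank_osuc by (simp add: tree_suc_def trec_osuc)
next
  case limit
  have "fs \<gamma> n < \<gamma>" if "n \<ge> 1" for n
    using increases_to_fs[OF limit assms(2)] that by (simp add: increases_to_def)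
  then show ?thesis
    unfolding child_rank_limit[OF limit] tree_suc_def
    by (intro trec_limit[OF limit]) simp
qed (use assms in simp)

lemma Cons_mem_tree_suc:
  assumes "countable_ordinal \<gamma>" "k # m \<in> tree_suc fs \<gamma>" "m \<noteq> []"
  shows "\<gamma> \<noteq> ozero" "k \<ge> 1" "m \<in> tree_suc fs (child_rank fs \<gamma> k)"
proof -
  show "\<gamma> \<noteq> ozero" using assms by (auto simp: tree_suc_ozero)
  then show "k \<ge> 1" "m \<in> tree_suc fs (child_rank fs \<gamma> k)"
    using assms by (auto simp: tree_suc_unfold)
qed

lemma Nil_notin_tree_suc: "countable_ordinal \<gamma> \<Longrightarrow> [] \<notin> tree_suc fs \<gamma>"
  by (cases "\<gamma> = ozero") (auto simp: tree_suc_ozero tree_suc_unfold)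

lemma singleton_mem_tree_suc: "countable_ordinal \<gamma> \<Longrightarrow> k \<ge> 1 \<Longrightarrow> [k] \<in> tree_suc fs \<gamma>"
  by (cases "\<gamma> = ozero") (auto simp: tree_suc_ozero tree_suc_unfold)

lemma subtree_tree_suc:
  assumes "\<gamma> \<noteq> ozero" "countable_ordinal \<gamma>" "k \<ge> 1"
  shows "subtree [k] (tree_suc fs \<gamma>) = tree_suc fs (child_rank fs \<gamma> k)"
proof -
  have "countable_ordinal (child_rank fs \<gamma> k)"
    using countable_ordinal_mono[OF assms(2)] child_rank_less[OF assms] by simp
  then show ?thesis
    using Cons_mem_tree_suc[OF assms(2), of k] Nil_notin_tree_suc assms
    by (auto simp: subtree_def) (auto simp: tree_suc_unfold)
qed

lemma iterate_tree_deriv_antimono: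
  "b \<le> c \<Longrightarrow> iterate tree_deriv T (c :: 'o) \<subseteq> iterate tree_deriv T b"
  by (rule iterate_antimono[where D = tree_deriv, OF tree_deriv_subset])

text \<open>A first-level node passes from \<open>\<beta>\<close> to its successor if some sibling
  is not maximal. A sibling \<open>j\<close> whose subtree has rank at least \<open>\<beta>\<close>
  is one, since by the outer induction its child \<open>[j, 1]\<close> is still present.\<close>

lemma singleton_mem_iterate:
  assumes "countable_ordinal \<gamma>" "\<beta> \<le> \<gamma>" "k \<ge> 1"
  shows "[k] \<in> iterate tree_deriv (tree_suc fs \<gamma>) \<beta>"
  using assms
proof (induction \<gamma> arbitrary: \<beta> k rule: less_induct)
  case (less \<gamma>)
  note outer = less.IH and \<gamma> = less.prems(1)
  show ?case using less.prems(2,3)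
  proof (induction \<beta> arbitrary: k rule: ordinal_induct)
    case zero
    then show ?case by (simp add: iterate_ozero singleton_mem_tree_suc[OF \<gamma>])
  next
    case (suc \<beta>)
    then have \<beta>: "\<beta> < \<gamma>" by (simp add: osuc_le_iff)
    then have \<gamma>0: "\<gamma> \<noteq> ozero" using ozero_le[of \<beta>] by auto
    obtain j where j: "j \<ge> 1" "\<beta> \<le> child_rank fs \<gamma> j" using child_rank_cofinal[OF \<gamma> \<beta>] by blast
    let ?G = "iterate tree_deriv (tree_suc fs \<gamma>) \<beta>"
    have less: "child_rank fs \<gamma> j < \<gamma>" using child_rank_less[OF \<gamma>0 \<gamma> j(1)] .
    have "[1] \<in> iterate tree_deriv (tree_suc fs (child_rank fs \<gamma> j)) \<beta>"
      using outer[OF less countable_ordinal_mono[OF \<gamma>] j(2)] less by simp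
    then have "[1] \<in> subtree [j] ?G"
      by (simp add: subtree_iterate subtree_tree_suc[OF \<gamma>0 \<gamma> j(1)])
    then have "[j] @ [1] \<in> ?G" by (simp add: subtree_def)
    then have "[j] \<notin> max_nodes ?G" unfolding max_nodes_def by blast
    moreover have "[j] \<in> ?G" "[k] \<in> ?G" using suc.IH j(1) suc.prems \<beta> by simp_all
    ultimately show ?case unfolding iterate_osuc tree_deriv_def using j(1) by auto
  next
    case (limit \<beta>)
    then show ?case by (simp add: iterate_limit)
  qed
qed

text \<open>All subtrees below the first level have rank less than \<open>\<gamma>\<close> and are
  exhausted at step \<open>\<gamma>\<close>. The remaining nodes are maximal, so one more derivation
  removes them.\<close>

lemma iterate_tree_suc_empty:
  assumes "countable_ordinal \<gamma>" "\<gamma> < \<beta>"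
  shows "iterate tree_deriv (tree_suc fs \<gamma>) \<beta> = {}"
  using assms
proof (induction \<gamma> arbitrary: \<beta> rule: less_induct)
  case (less \<gamma>)
  let ?G = "iterate tree_deriv (tree_suc fs \<gamma>) \<gamma>"
  have "?G \<subseteq> tree_suc fs \<gamma>"
    using iterate_tree_deriv_antimono[OF ozero_le[of \<gamma>]] by (simp add: iterate_ozero)
  have "m = []" if m: "k # m \<in> ?G" for k m
  proof (rule ccontr)
    assume "m \<noteq> []"
    have \<gamma>: "\<gamma> \<noteq> ozero" "k \<ge> 1"
      using Cons_mem_tree_suc[OF less.prems(1) _ \<open>m \<noteq> []\<close>] m \<open>?G \<subseteq> _\<close> by blast+
    have lt: "child_rank fs \<gamma> k < \<gamma>" using child_rank_less \<gamma> less.prems(1) by blast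
    have "m \<in> subtree [k] ?G" using m \<open>m \<noteq> []\<close> by (simp add: subtree_def)
    then have "m \<in> iterate tree_deriv (tree_suc fs (child_rank fs \<gamma> k)) \<gamma>"
      by (simp add: subtree_iterate subtree_tree_suc[OF \<gamma>(1) less.prems(1) \<gamma>(2)])
    then show False
      using less.IH[OF lt countable_ordinal_mono[OF less.prems(1)] lt] lt by simp
  qed
  then have no_extension: "r = []" if "(s @ [j]) @ r \<in> ?G" for s j r
    using that by (cases s) auto
  have "s @ [j] \<in> max_nodes ?G" if "s @ [j] \<in> ?G" for s j
    using that no_extension[of s j] unfolding max_nodes_def by blast
  then have "tree_deriv ?G = {}" unfolding tree_deriv_def by blast
  then have "iterate tree_deriv (tree_suc fs \<gamma>) (osuc \<gamma>) = {}" by (simp add: iterate_osuc)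
  then show ?case
    using iterate_tree_deriv_antimono[of "osuc \<gamma>" \<beta>] less.prems(2) by (simp add: osuc_le_iff) blast
qed

text \<open>Beyond the rank of its own subtree the node has no extensions left, while up to the rank
  \<open>\<gamma>\<close> of its parent it is still present.\<close>

lemma mem_max_nodes_iterate:
  assumes T: "subtree p T = tree_suc fs \<gamma>" and \<gamma>: "countable_ordinal \<gamma>" and "k \<ge> 1"
    and \<beta>: "\<beta> \<le> \<gamma>" "\<gamma> = ozero \<or> child_rank fs \<gamma> k < \<beta>"
  shows "p @ [k] \<in> max_nodes (iterate tree_deriv T \<beta>)"
proof -
  let ?G = "iterate tree_deriv (tree_suc fs \<gamma>) \<beta>"
  have "subtree [k] ?G = {}"
  proof (cases "\<gamma> = ozero")
    case True
    then have "\<beta> = ozero" using \<beta>(1) ozero_le[of \<beta>] by (simp add: order_antisym)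
    then show ?thesis using True by (auto simp: iterate_ozero tree_suc_ozero subtree_def)
  next
    case False
    then have "child_rank fs \<gamma> k < \<gamma>" using child_rank_less \<gamma> assms(3) by blast
    then have "countable_ordinal (child_rank fs \<gamma> k)" using countable_ordinal_mono[OF \<gamma>] by simp
    then show ?thesis
      using False \<beta> by (simp add: subtree_iterate subtree_tree_suc[OF False \<gamma> assms(3)] iterate_tree_suc_empty)
  qed
  then have "[k] \<in> max_nodes ?G"
    using singleton_mem_iterate[OF \<gamma> \<beta>(1) assms(3)] by (auto simp: max_nodes_def subtree_def)
  then show ?thesis using max_nodes_subtree[of "[k]" p "iterate tree_deriv T \<beta>"] by (simp add: subtree_iterate T)
qed

section \<open>Stages as a recursion on the rank\<close>

lemma stage_ozero: "stage T (ozero :: 'o) n = level_graph (levels n)"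
  and stage_osuc: "stage T (osuc (\<beta> :: 'o)) n =
    (if n \<in> max_nodes (iterate tree_deriv T \<beta>) then stage T \<beta> n
     else sup_amalgam (common_part n) (\<lambda>k. stage T \<beta> (n @ [k])))"
  and stage_limit: "is_limit (\<beta> :: 'o) \<Longrightarrow> stage T \<beta> n =
    (THE N. \<exists>\<gamma><\<beta>. \<forall>\<delta>. \<gamma> \<le> \<delta> \<and> \<delta> < \<beta> \<longrightarrow> stage T \<delta> n = N)"
proof -
  show "stage T (ozero :: 'o) n = level_graph (levels n)" by (simp add: stage_def trec_ozero)
  show "stage T (osuc (\<beta> :: 'o)) n =
    (if n \<in> max_nodes (iterate tree_deriv T \<beta>) then stage T \<beta> n
     else sup_amalgam (common_part n) (\<lambda>k. stage T \<beta> (n @ [k])))"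
    by (simp add: stage_def trec_osuc)
  assume lim: "is_limit \<beta>"
  have "stage T \<beta> = (\<lambda>n. THE N. \<exists>\<gamma><\<beta>. \<forall>\<delta>. \<gamma> \<le> \<delta> \<and> \<delta> < \<beta> \<longrightarrow> stage T \<delta> n = N)"
    unfolding stage_def
    by (rule trec_limit[OF lim]) (intro ext arg_cong[where f = The], metis)
  then show "stage T \<beta> n = (THE N. \<exists>\<gamma><\<beta>. \<forall>\<delta>. \<gamma> \<le> \<delta> \<and> \<delta> < \<beta> \<longrightarrow> stage T \<delta> n = N)"
    by (rule fun_cong)
qed

text \<open>At limits this also supplies the unique eventual value that the \<open>THE\<close> in
  \<open>stage\<close> asks for.\<close>

lemma stage_constant:
  fixes \<beta> :: 'o
  assumes "\<beta>\<^sub>0 \<le> \<beta>" "\<And>\<delta>. \<beta>\<^sub>0 \<le> \<delta> \<Longrightarrow> \<delta> < \<beta> \<Longrightarrow> n \<in> max_nodes (iterate tree_deriv T \<delta>)"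
  shows "stage T \<beta> n = stage T \<beta>\<^sub>0 n"
  using assms
proof (induction \<beta> rule: ordinal_induct)
  case zero
  then show ?case using ozero_le[of \<beta>\<^sub>0] by (simp add: order_antisym)
next
  case (suc \<beta>)
  show ?case
  proof (cases "\<beta>\<^sub>0 = osuc \<beta>")
    case False
    then have le: "\<beta>\<^sub>0 \<le> \<beta>" using suc.prems(1) less_osuc_iff by (metis order_le_less)
    then have "stage T \<beta> n = stage T \<beta>\<^sub>0 n"
      using suc.IH suc.prems(2) by (simp add: less_osuc_iff)
    then show ?thesis using suc.prems(2)[OF le osuc_greater] by (simp add: stage_osuc)
  qed simp
next
  case (limit \<beta>)
  show ?case
  proof (cases "\<beta>\<^sub>0 = \<beta>")
    case False
    then have lt: "\<beta>\<^sub>0 < \<beta>" using limit.prems(1) by simp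
    have const: "stage T \<delta> n = stage T \<beta>\<^sub>0 n" if "\<beta>\<^sub>0 \<le> \<delta>" "\<delta> < \<beta>" for \<delta>
      using limit(2)[OF that(2,1)] limit.prems(2) that by (meson order_less_trans)
    show ?thesis unfolding stage_limit[OF limit(1)]
    proof (rule the_equality)
      show "\<exists>\<gamma><\<beta>. \<forall>\<delta>. \<gamma> \<le> \<delta> \<and> \<delta> < \<beta> \<longrightarrow> stage T \<delta> n = stage T \<beta>\<^sub>0 n" using lt const by blast
      fix N assume "\<exists>\<gamma><\<beta>. \<forall>\<delta>. \<gamma> \<le> \<delta> \<and> \<delta> < \<beta> \<longrightarrow> stage T \<delta> n = N"
      then obtain \<gamma> where "\<gamma> < \<beta>" "\<And>\<delta>. \<gamma> \<le> \<delta> \<Longrightarrow> \<delta> < \<beta> \<Longrightarrow> stage T \<delta> n = N" by blast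
      \<comment> \<open>Both eventual values are compared at the common index
        \<open>max \<gamma> \<beta>\<^sub>0\<close>.\<close>
      then show "N = stage T \<beta>\<^sub>0 n" using const[of "max \<gamma> \<beta>\<^sub>0"] lt by simp
    qed
  qed simp
qed

text \<open>At the derivative of order \<open>child_rank fs \<gamma> k\<close> the node still has a
  child, so the next stage forms an amalgam. From then on up to \<open>\<gamma>\<close> the node is
  maximal and its space no longer changes.\<close>

lemma stage_node:
  assumes T: "subtree p T = tree_suc fs \<gamma>" and \<gamma>: "\<gamma> \<noteq> ozero" "countable_ordinal \<gamma>" and "k \<ge> 1"
  shows "stage T \<gamma> (p @ [k]) = node_space T (child_rank fs \<gamma> k) (p @ [k])"
proof -
  let ?\<delta> = "child_rank fs \<gamma> k" and ?n = "p @ [k]"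
  have lt: "?\<delta> < \<gamma>" using child_rank_less \<gamma> assms(4) by blast
  have "?n @ [1] \<in> iterate tree_deriv T ?\<delta>"
  proof -
    have "subtree ?n T = tree_suc fs ?\<delta>" by (simp add: subtree_append T subtree_tree_suc[OF \<gamma> assms(4)])
    then have "[1] \<in> subtree ?n (iterate tree_deriv T ?\<delta>)"
      using singleton_mem_iterate[of ?\<delta> ?\<delta> 1] countable_ordinal_mono[OF \<gamma>(2)] lt
      by (simp add: subtree_iterate)
    then show ?thesis by (simp add: subtree_def)
  qed
  then have "?n \<notin> max_nodes (iterate tree_deriv T ?\<delta>)" unfolding max_nodes_def by blast
  then have "stage T (osuc ?\<delta>) ?n = node_space T ?\<delta> ?n" by (simp add: stage_osuc node_space_def)
  moreover have "stage T \<gamma> ?n = stage T (osuc ?\<delta>) ?n"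
    using lt mem_max_nodes_iterate[OF T \<gamma>(2) assms(4)]
    by (intro stage_constant) (auto simp: osuc_le_iff)
  ultimately show ?thesis by simp
qed

lemma M_suc_eq: "M_suc fs \<mu> = node_space (tree_suc fs \<mu>) \<mu> []"
  by (simp add: M_suc_def node_space_def)

end

section \<open>Separating functionals\<close>

text \<open>The invariant carried towards the root. One functional must serve all pairs of vertices
  at once; only images of vertices enter, so the property makes sense on the part common to all
  factors.\<close>

definition separating ::
    "real \<Rightarrow> nat list \<Rightarrow> (point \<Rightarrow> 'x::real_normed_vector) \<Rightarrow> ('x \<Rightarrow>\<^sub>L real) set \<Rightarrow> bool" where
  "separating \<eta> p f K \<longleftrightarrow>
     (\<forall>S\<in>faces (levels p). \<forall>S'\<in>faces (levels p). S \<inter> S' = {} \<longrightarrow>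
        (\<exists>\<phi>\<in>K. \<forall>a\<in>S. \<forall>b\<in>S'. \<eta> \<le> \<phi> (f (Vertex a)) - \<phi> (f (Vertex b))))"

lemma separatingD:
  assumes "separating \<eta> p f K" "S \<in> faces (levels p)" "S' \<in> faces (levels p)" "S \<inter> S' = {}"
  obtains \<phi> where "\<phi> \<in> K" "\<And>a b. a \<in> S \<Longrightarrow> b \<in> S' \<Longrightarrow> \<eta> \<le> \<phi> (f (Vertex a)) - \<phi> (f (Vertex b))"
  using assms(1)[unfolded separating_def, rule_format, OF assms(2-4)] that by blast

lemma separating_mono: "separating \<eta> p f K \<Longrightarrow> K \<subseteq> L \<Longrightarrow> separating \<eta> p f L"
  unfolding separating_def by (meson subsetD)

lemma separating_cong:
  assumes "\<And>a. a \<in> \<Union>(set (levels p)) \<Longrightarrow> f (Vertex a) = g (Vertex a)"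
  shows "separating \<eta> p f K \<longleftrightarrow> separating \<eta> p g K"
proof -
  have "f (Vertex a) = g (Vertex a)" if "S \<in> faces (levels p)" "a \<in> S" for S a
    using assms faces_subset that by blast
  then show ?thesis unfolding separating_def by simp
qed

lemma separating_incl:
  "separating \<eta> p (f \<circ> incl (common_part p) k) K \<longleftrightarrow> separating \<eta> p f K"
  by (rule separating_cong) (simp only: comp_def incl_def Vertex_mem_common_part if_True)

text \<open>Disjoint faces are extended by two different new vertices, which exist once
  \<open>k \<ge> 2\<close>. The functional separating the extensions separates the original
  faces.\<close>

lemma separating_parent:
  assumes "separating \<eta> (p @ [k]) f K" "k \<ge> 2"
  shows "separating \<eta> p f K"
  unfolding separating_def
proof (intro ballI impI)
  fix S S' assume S: "S \<in> faces (levels p)" "S' \<in> faces (levels p)" "S \<inter> S' = {}"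
  let ?n = "Suc (length p)"
  obtain \<phi> where "\<phi> \<in> K"
    "\<And>a b. a \<in> insert (?n, 1) S \<Longrightarrow> b \<in> insert (?n, 2) S' \<Longrightarrow> \<eta> \<le> \<phi> (f (Vertex a)) - \<phi> (f (Vertex b))"
  proof (rule separatingD[OF assms(1)])
    show "insert (?n, 1) S \<in> faces (levels (p @ [k]))" "insert (?n, 2) S' \<in> faces (levels (p @ [k]))"
      using S assms(2) by (intro insert_mem_faces_levels; simp)+
    show "insert (?n, 1) S \<inter> insert (?n, 2) S' = {}"
      using S by (intro insert_disjoint_faces_levels) auto
  qed blast
  then show "\<exists>\<phi>\<in>K. \<forall>a\<in>S. \<forall>b\<in>S'. \<eta> \<le> \<phi> (f (Vertex a)) - \<phi> (f (Vertex b))" by blast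
qed

lemma closedin_separating:
  fixes f :: "'b \<Rightarrow> 'x::real_normed_vector"
  shows "closedin weak_star {\<phi> :: 'x \<Rightarrow>\<^sub>L real. \<forall>a\<in>S. \<forall>b\<in>S'. \<eta> \<le> \<phi> (f a) - \<phi> (f b)}"
proof -
  have "openin weak_star {\<phi> :: 'x \<Rightarrow>\<^sub>L real. \<not> \<eta> \<le> \<phi> (f a) - \<phi> (f b)}" for a b
  proof -
    have "openin weak_star {\<phi> \<in> topspace weak_star. blinfun_apply \<phi> (f a - f b) \<in> {..<\<eta>}}"
      by (rule openin_continuous_map_preimage[OF strong_operator_topology_continuous_evaluation]) auto
    then show ?thesis by (simp add: strong_operator_topology_topspace blinfun.diff_right not_le)
  qed
  then have "openin weak_star (\<Union>a\<in>S. \<Union>b\<in>S'. {\<phi> :: 'x \<Rightarrow>\<^sub>L real. \<not> \<eta> \<le> \<phi> (f a) - \<phi> (f b)})"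
    by (intro openin_Union) auto
  moreover have "(\<Union>a\<in>S. \<Union>b\<in>S'. {\<phi> :: 'x \<Rightarrow>\<^sub>L real. \<not> \<eta> \<le> \<phi> (f a) - \<phi> (f b)}) =
      UNIV - {\<phi> :: 'x \<Rightarrow>\<^sub>L real. \<forall>a\<in>S. \<forall>b\<in>S'. \<eta> \<le> \<phi> (f a) - \<phi> (f b)}"
    by blast
  ultimately show ?thesis unfolding closedin_def by (simp add: strong_operator_topology_topspace)
qed

section \<open>Separation at the leaves, at successors and at limits\<close>

text \<open>A functional norming the difference of the two face points gains \<open>4 * C1\<close>
  from their distance 4. Moving from each face to one of its vertices costs at most
  \<open>C2\<close>, since they are adjacent.\<close>

lemma separating_level_graph:
  fixes f :: "point \<Rightarrow> 'x::banach"
  assumes f: "bilipschitz_with (level_graph (levels p)) f C1 C2"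
  shows "separating (4 * C1 - 2 * C2) p f (cball 0 1)"
  unfolding separating_def
proof (intro ballI impI)
  let ?N = "level_graph (levels p)"
  fix S S' assume S: "S \<in> faces (levels p)" "S' \<in> faces (levels p)" "S \<inter> S' = {}"
  obtain \<phi> :: "'x \<Rightarrow>\<^sub>L real" where \<phi>: "norm \<phi> \<le> 1"
    "\<phi> (f (Face S) - f (Face S')) = norm (f (Face S) - f (Face S'))"
    using norming_functional .
  have mem: "Face U \<in> fst ?N" "\<And>a. a \<in> U \<Longrightarrow> Vertex a \<in> fst ?N" if "U \<in> faces (levels p)" for U
    using that faces_subset[OF that] by (auto simp: level_graph_def graph_points_def)
  have C: "C1 > 0" "C2 > 0" using f by (auto simp: bilipschitz_with_def)
  have upper: "\<phi> (f x) - \<phi> (f y) \<le> C2" if "x \<in> fst ?N" "y \<in> fst ?N" "snd ?N x y \<le> 1" for x y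
  proof -
    have "\<phi> (f x - f y) \<le> norm \<phi> * norm (f x - f y)" using norm_blinfun[of \<phi> "f x - f y"] by simp
    also have "\<dots> \<le> 1 * norm (f x - f y)" using \<phi>(1) by (intro mult_right_mono) auto
    also have "\<dots> \<le> C2 * snd ?N x y" using f that by (simp add: bilipschitz_with_def dist_norm)
    also have "\<dots> \<le> C2" using that(3) C by (simp add: mult_le_cancel_left2)
    finally show ?thesis by (simp add: blinfun.diff_right)
  qed
  have "C1 * 4 \<le> C1 * snd ?N (Face S) (Face S')"
    using level_graph_dist_Face_Face[OF levels_nonempty S] C by (intro mult_left_mono) auto
  also have "\<dots> \<le> \<phi> (f (Face S)) - \<phi> (f (Face S'))"
    using f mem(1)[OF S(1)] mem(1)[OF S(2)] \<phi>(2)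
    by (simp add: bilipschitz_with_def dist_norm blinfun.diff_right)
  finally have lower: "4 * C1 \<le> \<phi> (f (Face S)) - \<phi> (f (Face S'))" by simp
  have "4 * C1 - 2 * C2 \<le> \<phi> (f (Vertex a)) - \<phi> (f (Vertex b))" if "a \<in> S" "b \<in> S'" for a b
  proof -
    have "\<phi> (f (Face S)) - \<phi> (f (Vertex a)) \<le> C2"
      using level_graph_dist_Vertex_Face(1)[OF levels_nonempty S(1) that(1)]
      by (rule upper[OF mem(1)[OF S(1)] mem(2)[OF S(1) that(1)]])
    moreover have "\<phi> (f (Vertex b)) - \<phi> (f (Face S')) \<le> C2"
      using level_graph_dist_Vertex_Face(2)[OF levels_nonempty S(2) that(2)]
      by (rule upper[OF mem(2)[OF S(2) that(2)] mem(1)[OF S(2)]])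
    ultimately show ?thesis using lower by simp
  qed
  then show "\<exists>\<phi>\<in>cball (0 :: 'x \<Rightarrow>\<^sub>L real) 1. \<forall>a\<in>S. \<forall>b\<in>S'. 4 * C1 - 2 * C2 \<le> \<phi> (f (Vertex a)) - \<phi> (f (Vertex b))"
    using \<phi>(1) by (intro bexI[of _ \<phi>]) auto
qed

lemma separating_szlenk_deriv:
  fixes f :: "point \<Rightarrow> 'x::banach"
  assumes M: "\<And>k. k \<ge> 1 \<Longrightarrow> admissible (common_part (p @ [k])) (M k)"
    and f: "bilipschitz_with (sup_amalgam (common_part p) M) f C1 C2"
    and sep: "\<And>k. k \<ge> 1 \<Longrightarrow> separating \<eta> (p @ [k]) (f \<circ> incl (common_part p) k) K"
    and K: "closedin weak_star K" "K \<subseteq> cball 0 1" and "\<eta> > 0"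
  shows "separating \<eta> p f (szlenk_deriv (\<eta> / (4 * C2)) K)"
  unfolding separating_def
proof (intro ballI impI)
  fix S S' assume S: "S \<in> faces (levels p)" "S' \<in> faces (levels p)" "S \<inter> S' = {}"
  let ?n = "Suc (length p)" and ?A = "common_part p"
  let ?f = "\<lambda>k. f \<circ> incl ?A k"
  let ?W = "{\<phi> :: 'x \<Rightarrow>\<^sub>L real. \<forall>a\<in>S. \<forall>b\<in>S'. \<eta> \<le> \<phi> (f (Vertex a)) - \<phi> (f (Vertex b))}"
  \<comment> \<open>Subtracting the image of \<open>Origin\<close> leaves the differences unchanged
    and bounds the norms by \<open>C2\<close>, because vertices have distance 1 from
    \<open>Origin\<close>.\<close>
  define u where "u k i = ?f k (Vertex (?n, i)) - f Origin" for k i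
  have C2: "C2 > 0" using f by (simp add: bilipschitz_with_def)
  have MA: "admissible ?A (M k)" if "k \<ge> 1" for k
    using admissible_subset[OF M[OF that] common_part_append] .
  have "szlenk_deriv (\<eta> / (4 * C2)) K \<inter> ?W \<noteq> {}"
  proof (rule szlenk_deriv_meets_closedin[OF K _ \<open>\<eta> > 0\<close> C2])
    show "closedin weak_star ?W" by (rule closedin_separating)
    show "norm (u k i) \<le> C2" if i: "1 \<le> i" "i \<le> k" for k i
    proof -
      have k: "k \<ge> 1" using i by simp
      have mem: "Vertex (?n, i) \<in> common_part (p @ [k])" "Origin \<in> common_part (p @ [k])"
        using i by (auto simp: common_part_def levels_append segment_def)
      have "bilipschitz_with (M k) (?f k) C1 C2"
        by (rule bilipschitz_with_incl[OF Origin_mem_common_part Family_notin_common_part MA f k])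
      then have "dist (?f k (Vertex (?n, i))) (?f k Origin) \<le> C2 * snd (M k) (Vertex (?n, i)) Origin"
        using mem admissibleD(1)[OF M[OF k]] unfolding bilipschitz_with_def by blast
      also have "snd (M k) (Vertex (?n, i)) Origin = 1"
        using admissibleD(2)[OF M[OF k] mem] by (simp add: base_dist_def)
      finally show ?thesis by (simp add: u_def dist_norm incl_def Origin_mem_common_part)
    qed
    show "\<exists>\<phi>\<in>K \<inter> ?W. \<eta> \<le> \<phi> (u k i) - \<phi> (u k j)"
      if ij: "1 \<le> i" "i \<le> k" "1 \<le> j" "j \<le> k" "i \<noteq> j" for k i j
    proof -
      have k: "k \<ge> 1" using ij by simp
      obtain \<phi> where \<phi>: "\<phi> \<in> K" "\<And>a b. a \<in> insert (?n, i) S \<Longrightarrow> b \<in> insert (?n, j) S' \<Longrightarrow>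
          \<eta> \<le> \<phi> (?f k (Vertex a)) - \<phi> (?f k (Vertex b))"
        by (rule separatingD[OF sep[OF k] insert_mem_faces_levels[OF S(1) ij(1,2)]
              insert_mem_faces_levels[OF S(2) ij(3,4)] insert_disjoint_faces_levels[OF S ij(5)]]) blast
      have "?f k (Vertex a) = f (Vertex a)" if "a \<in> S \<union> S'" for a
      proof -
        have "Vertex a \<in> ?A"
          using that faces_subset[OF S(1)] faces_subset[OF S(2)] Vertex_mem_common_part by blast
        then show ?thesis by (simp add: incl_def)
      qed
      then have "\<phi> \<in> ?W" using \<phi>(2) by fastforce
      moreover have "\<eta> \<le> \<phi> (u k i) - \<phi> (u k j)"
        using \<phi>(2)[of "(?n, i)" "(?n, j)"] by (simp add: u_def blinfun.diff_right)
      ultimately show ?thesis using \<phi>(1) by blast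
    qed
  qed
  then show "\<exists>\<phi>\<in>szlenk_deriv (\<eta> / (4 * C2)) K. \<forall>a\<in>S. \<forall>b\<in>S'. \<eta> \<le> \<phi> (f (Vertex a)) - \<phi> (f (Vertex b))"
    by blast
qed

text \<open>For fixed faces the separating functionals form a weak* closed set, so compactness gives
  one in the whole intersection.\<close>

lemma separating_INT:
  fixes f :: "point \<Rightarrow> 'x::banach" and K :: "nat \<Rightarrow> ('x \<Rightarrow>\<^sub>L real) set"
  assumes "\<And>k. k \<in> I \<Longrightarrow> separating \<eta> p f (K k)"
    and "\<And>k. k \<in> I \<Longrightarrow> closedin weak_star (K k)" "\<And>k. k \<in> I \<Longrightarrow> K k \<subseteq> cball 0 1"
    and "\<And>k l. k \<in> I \<Longrightarrow> l \<in> I \<Longrightarrow> k \<le> l \<Longrightarrow> K l \<subseteq> K k" and "I \<noteq> {}"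
  shows "separating \<eta> p f (\<Inter>k\<in>I. K k)"
  unfolding separating_def
proof (intro ballI impI)
  fix S S' assume S: "S \<in> faces (levels p)" "S' \<in> faces (levels p)" "S \<inter> S' = {}"
  let ?W = "{\<phi> :: 'x \<Rightarrow>\<^sub>L real. \<forall>a\<in>S. \<forall>b\<in>S'. \<eta> \<le> \<phi> (f (Vertex a)) - \<phi> (f (Vertex b))}"
  have "(\<Inter>k\<in>I. K k) \<inter> ?W \<noteq> {}"
  proof (rule ex_in_INT_weak_star[OF assms(2,3) closedin_separating[where f = "\<lambda>a. f (Vertex a)"] assms(4) _ assms(5)])
    show "K k \<inter> ?W \<noteq> {}" if k: "k \<in> I" for k
    proof -
      obtain \<phi> where "\<phi> \<in> K k" "\<phi> \<in> ?W" by (rule separatingD[OF assms(1)[OF k] S]) blast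
      then show ?thesis by blast
    qed
  qed
  then show "\<exists>\<phi>\<in>\<Inter>k\<in>I. K k. \<forall>a\<in>S. \<forall>b\<in>S'. \<eta> \<le> \<phi> (f (Vertex a)) - \<phi> (f (Vertex b))" by blast
qed

lemma separating_szlenk_iter_limit:
  fixes f :: "point \<Rightarrow> 'x::banach"
  assumes b: "is_limit b" and s: "increases_to s b"
    and "\<And>k. k \<ge> 2 \<Longrightarrow> separating \<eta> p f (szlenk_iter \<epsilon> (s k))"
  shows "separating \<eta> p f (szlenk_iter \<epsilon> b)"
proof -
  have mono: "s k \<le> s l" if "k \<in> {2..}" "l \<in> {2..}" "k \<le> l" for k l
    using s that unfolding increases_to_def by (auto simp: strict_mono_on_leD)
  have "\<exists>k\<in>{2..}. c \<le> s k" if c: "c < b" for c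
  proof -
    obtain k where "k \<ge> 1" "c < s k" using s c unfolding increases_to_def by blast
    moreover from this have "s k < s (Suc k)"
      using s unfolding increases_to_def by (auto dest: strict_mono_onD)
    \<comment> \<open>The tail from index 2, where two new vertices are available, stays cofinal:
      the index found may be 1, but its successor is at least 2.\<close>
    ultimately show ?thesis by (intro bexI[of _ "Suc k"]) auto
  qed
  moreover have "s k < b" if "k \<in> {2..}" for k using s that unfolding increases_to_def by simp
  ultimately have "szlenk_iter \<epsilon> b = (\<Inter>k\<in>{2..}. szlenk_iter \<epsilon> (s k) :: ('x \<Rightarrow>\<^sub>L real) set)"
    unfolding szlenk_iter_def
    by (intro iterate_limit_cofinal[where D = "szlenk_deriv \<epsilon>", OF szlenk_deriv_subset b])
  moreover have "separating \<eta> p f (\<Inter>k\<in>{2..}. szlenk_iter \<epsilon> (s k))"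
    using assms(3) mono
    by (intro separating_INT) (auto intro!: closedin_szlenk_iter szlenk_iter_subset dest!: szlenk_iter_antimono)
  ultimately show ?thesis by simp
qed

section \<open>Induction on the rank of a node\<close>

text \<open>The two claims are proved together: the node space amalgamates the stages of its
  children, which for nonzero rank are node spaces of smaller rank.\<close>

lemma admissible_node_space:
  fixes fs :: "'o::{wellorder,no_top} \<Rightarrow> nat \<Rightarrow> 'o"
  assumes fs: "fundamental_sequences fs" and "countable_ordinal \<gamma>" "subtree p T = tree_suc fs \<gamma>"
  shows "admissible (common_part p) (node_space T \<gamma> p) \<and>
    (\<forall>k\<ge>1. admissible (common_part (p @ [k])) (stage T \<gamma> (p @ [k])))"
  using assms(2,3)
proof (induction \<gamma> arbitrary: p rule: less_induct)
  case (less \<gamma>)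
  have child: "admissible (common_part (p @ [k])) (stage T \<gamma> (p @ [k]))" if k: "k \<ge> 1" for k
  proof (cases "\<gamma> = ozero")
    case True
    then show ?thesis by (simp add: stage_ozero[OF fs] admissible_level_graph_levels)
  next
    case False
    have lt: "child_rank fs \<gamma> k < \<gamma>" using child_rank_less[OF fs False] less.prems k by blast
    moreover have "subtree (p @ [k]) T = tree_suc fs (child_rank fs \<gamma> k)"
      by (simp add: subtree_append less.prems(2) subtree_tree_suc[OF fs False less.prems(1) k])
    ultimately show ?thesis
      unfolding stage_node[OF fs less.prems(2) False less.prems(1) k]
      using less.IH countable_ordinal_mono[OF less.prems(1)] by simp
  qed
  have "admissible (common_part p) (node_space T \<gamma> p)"
    unfolding node_space_def
    using admissible_subset[OF child common_part_append]
    by (intro admissible_sup_amalgam Origin_mem_common_part Family_notin_common_part)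
  then show ?case using child by blast
qed

text \<open>Induction on the rank: a successor rank gains one derivative over the children, a limit
  rank takes an intersection. The second claim records the derivative already gained at rank zero;
  it is used for \<open>\<alpha> = ozero\<close>, where the space comes from rank zero and the first
  derivative is required.\<close>

lemma separating_node_space:
  fixes f :: "point \<Rightarrow> 'x::banach"
    and fs :: "('x \<Rightarrow>\<^sub>L real) ordinal \<Rightarrow> nat \<Rightarrow> ('x \<Rightarrow>\<^sub>L real) ordinal"
  assumes fs: "fundamental_sequences fs" and C: "2 * C2 < 4 * C1"
    and "countable_ordinal \<gamma>" "subtree p T = tree_suc fs \<gamma>"
    and "bilipschitz_with (node_space T \<gamma> p) f C1 C2"
  defines "\<eta> \<equiv> 4 * C1 - 2 * C2"
  shows "separating \<eta> p f (szlenk_iter (\<eta> / (4 * C2)) \<gamma>) \<and>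
    (\<gamma> = ozero \<longrightarrow> separating \<eta> p f (szlenk_iter (\<eta> / (4 * C2)) (osuc \<gamma>)))"
  using assms(3-5)
proof (induction \<gamma> arbitrary: p f rule: less_induct)
  case (less \<gamma>)
  note \<gamma> = less.prems(1) and T = less.prems(2) and f = less.prems(3)
  have \<eta>: "\<eta> > 0" using C by (simp add: \<eta>_def)
  let ?K = "szlenk_iter (\<eta> / (4 * C2)) :: _ \<Rightarrow> ('x \<Rightarrow>\<^sub>L real) set"
  let ?f = "\<lambda>k. f \<circ> incl (common_part p) k"
  have child_admissible: "admissible (common_part (p @ [k])) (stage T \<gamma> (p @ [k]))" if "k \<ge> 1" for k
    using admissible_node_space[OF fs \<gamma> T] that by blast
  have f_child: "bilipschitz_with (stage T \<gamma> (p @ [k])) (?f k) C1 C2" if "k \<ge> 1" for k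
    using f that unfolding node_space_def
    by (intro bilipschitz_with_incl[where M = "\<lambda>k. stage T \<gamma> (p @ [k])"] Origin_mem_common_part
        Family_notin_common_part admissible_subset[OF child_admissible common_part_append])
  have step: "separating \<eta> p f (szlenk_deriv (\<eta> / (4 * C2)) K)"
    if "\<And>k. k \<ge> 1 \<Longrightarrow> separating \<eta> (p @ [k]) (?f k) K" "closedin weak_star K" "K \<subseteq> cball 0 1" for K
    using f child_admissible that \<eta> unfolding node_space_def by (intro separating_szlenk_deriv)
  have child: "separating \<eta> (p @ [k]) (?f k) (?K (child_rank fs \<gamma> k))" if \<gamma>0: "\<gamma> \<noteq> ozero" and k: "k \<ge> 1" for k
  proof -
    have lt: "child_rank fs \<gamma> k < \<gamma>" using child_rank_less[OF fs \<gamma>0 \<gamma> k] .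
    have "subtree (p @ [k]) T = tree_suc fs (child_rank fs \<gamma> k)"
      by (simp add: subtree_append T subtree_tree_suc[OF fs \<gamma>0 \<gamma> k])
    then show ?thesis
      using less.IH[OF lt] countable_ordinal_mono[OF \<gamma>] lt f_child[OF k]
      unfolding stage_node[OF fs T \<gamma>0 \<gamma> k] by simp
  qed
  have base: "separating \<eta> p f (?K (osuc \<gamma>))" if \<gamma>0: "\<gamma> = ozero"
  proof -
    have "separating \<eta> (p @ [k]) (?f k) (cball 0 1)" if "k \<ge> 1" for k
      using separating_level_graph f_child[OF that] unfolding \<gamma>0 stage_ozero[OF fs] \<eta>_def by blast
    then show ?thesis
      unfolding szlenk_iter_def \<gamma>0 iterate_osuc iterate_ozero
      by (intro step closedin_weak_star_cball) auto
  qed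
  have "separating \<eta> p f (?K \<gamma>)"
  proof (cases \<gamma> rule: ordinal_cases)
    case zero
    show ?thesis
      using separating_mono[OF base[OF zero] szlenk_iter_antimono] osuc_greater less_imp_le by blast
  next
    case (suc \<delta>)
    have "?K \<gamma> = szlenk_deriv (\<eta> / (4 * C2)) (?K \<delta>)" by (simp add: suc szlenk_iter_def iterate_osuc)
    moreover have "separating \<eta> p f (szlenk_deriv (\<eta> / (4 * C2)) (?K \<delta>))"
    proof (rule step[OF _ closedin_szlenk_iter szlenk_iter_subset])
      show "separating \<eta> (p @ [k]) (?f k) (?K \<delta>)" if "k \<ge> 1" for k
        using child[OF _ that] osuc_neq_ozero[of \<delta>] unfolding suc child_rank_osuc[OF fs] by blast
    qed
    ultimately show ?thesis by simp
  next
    case limit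
    then have \<gamma>0: "\<gamma> \<noteq> ozero" by (simp add: is_limit_def)
    \<comment> \<open>At a limit the properties of the children are first passed to \<open>p\<close>
      itself, so that they concern the same faces and can be intersected.\<close>
    show ?thesis
    proof (rule separating_szlenk_iter_limit[OF limit increases_to_fs[OF fs limit \<gamma>]])
      fix k :: nat assume k: "k \<ge> 2"
      then have "separating \<eta> (p @ [k]) (?f k) (?K (fs \<gamma> k))"
        using child[OF \<gamma>0, of k] by (simp add: child_rank_limit[OF fs limit])
      then show "separating \<eta> p f (?K (fs \<gamma> k))"
        using separating_parent[OF _ k] separating_incl by blast
    qed
  qed
  then show ?case using base by blast
qed

theorem theorem15:
  fixes \<alpha> :: "('x::banach \<Rightarrow>\<^sub>L real) ordinal"
    and fs ms :: "('x \<Rightarrow>\<^sub>L real) ordinal \<Rightarrow> nat \<Rightarrow> ('x \<Rightarrow>\<^sub>L real) ordinal"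
  assumes "countable_ordinal \<alpha>"
    and "fundamental_sequences fs"
    and "fundamental_sequences ms"
    and "asplund TYPE('x)"
    and "\<exists>f :: point \<Rightarrow> 'x. lipschitz_embedding (M_space fs ms (omega_power \<alpha>)) f \<and>
           distortion (M_space fs ms (omega_power \<alpha>)) f < 2"
  shows "szlenk_index TYPE('x) \<ge> Fin (omega_power (osuc \<alpha>))"
proof -
  let ?o = "omega_power \<alpha>" and ?A = "common_part []"
  let ?N = "M_space fs ms ?o"
  obtain f :: "point \<Rightarrow> 'x" where emb: "lipschitz_embedding ?N f" "distortion ?N f < 2"
    using assms(5) by blast
  \<comment> \<open>The set of ratios is nonempty, so an infimum below 2 yields an actual pair of
    constants with ratio below 2.\<close>
  have "{C2 / C1 | C1 C2. bilipschitz_with ?N f C1 C2} \<noteq> {}"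
    using emb(1) unfolding lipschitz_embedding_def by blast
  then have "\<exists>r\<in>{C2 / C1 | C1 C2. bilipschitz_with ?N f C1 C2}. r < 2"
    using emb(2) unfolding distortion_def by (intro cInf_lessD) auto
  then obtain C1 C2 where f: "bilipschitz_with ?N f C1 C2" and "C2 / C1 < 2" by blast
  then have C: "C1 > 0" "C2 > 0" "2 * C2 < 4 * C1" by (auto simp: bilipschitz_with_def field_simps)
  define \<eta> where "\<eta> = 4 * C1 - 2 * C2"
  let ?K = "szlenk_iter (\<eta> / (4 * C2)) :: _ \<Rightarrow> ('x \<Rightarrow>\<^sub>L real) set"
  have o: "countable_ordinal ?o" using countable_omega_power assms(1) .
  have whole: "subtree [] (tree_suc fs \<mu>) = tree_suc fs \<mu>" if "countable_ordinal \<mu>" for \<mu>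
    using Nil_notin_tree_suc[OF assms(2) that] by (auto simp: subtree_def)
  have sep: "separating \<eta> [] f (?K ?o)"
  proof (cases "\<alpha> = ozero")
    case True
    \<comment> \<open>Here the exponent is zero and the power is 1, a successor: the space is the
      node space of rank zero.\<close>
    then have o1: "?o = osuc ozero" by (simp add: omega_power_ozero)
    have "is_osuc (osuc ozero :: ('x \<Rightarrow>\<^sub>L real) ordinal)" unfolding is_osuc_def by blast
    then have N: "?N = node_space (tree_suc fs ozero) (ozero :: ('x \<Rightarrow>\<^sub>L real) ordinal) []"
      unfolding M_space_def o1 by (simp add: opred_osuc M_suc_eq[OF assms(2)])
    show ?thesis
      using separating_node_space[OF assms(2) C(3) countable_ordinal_ozero whole[OF countable_ordinal_ozero] f[unfolded N]]
      unfolding \<eta>_def o1 by blast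
  next
    case False
    then have lim: "is_limit ?o" using is_limit_omega_power assms(1) by blast
    then have s: "increases_to (ms ?o) ?o" using assms(3) o by (simp add: fundamental_sequences_def)
    \<comment> \<open>For nonzero exponents the power is a limit, and the space amalgamates
      successor spaces whose ranks increase to it.\<close>
    have N: "?N = sup_amalgam ?A (\<lambda>n. M_suc fs (ms ?o n))"
      using lim by (simp add: M_space_def is_limit_def)
    have cnt: "countable_ordinal (ms ?o k)" if "k \<ge> 1" for k
    proof -
      have "ms ?o k < ?o" using s that unfolding increases_to_def by blast
      then show ?thesis using countable_ordinal_mono[OF o less_imp_le] by blast
    qed
    show ?thesis
    proof (rule separating_szlenk_iter_limit[OF lim s])
      fix k :: nat assume "k \<ge> 2"
      then have k: "k \<ge> 1" by simp
      have "bilipschitz_with (M_suc fs (ms ?o k)) (f \<circ> incl ?A k) C1 C2"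
      proof (rule bilipschitz_with_incl[OF Origin_mem_common_part Family_notin_common_part _ _ k,
            where M = "\<lambda>n. M_suc fs (ms ?o n)"])
        show "admissible ?A (M_suc fs (ms ?o j))" if "j \<ge> 1" for j
          unfolding M_suc_eq[OF assms(2)] using admissible_node_space[OF assms(2) cnt[OF that] whole[OF cnt[OF that]]] by blast
        show "bilipschitz_with (sup_amalgam ?A (\<lambda>n. M_suc fs (ms ?o n))) f C1 C2"
          using f unfolding N .
      qed
      then have "separating \<eta> [] (f \<circ> incl ?A k) (?K (ms ?o k))"
        unfolding \<eta>_def M_suc_eq[OF assms(2)]
        by (rule separating_node_space[OF assms(2) C(3) cnt[OF k] whole[OF cnt[OF k]], THEN conjunct1])
      then show "separating \<eta> [] f (?K (ms ?o k))" by (simp only: separating_incl)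
    qed
  qed
  \<comment> \<open>The two points of the level \<open>segment 0 2\<close> form disjoint faces at
    the root; separating them only serves to produce an element of the derivative.\<close>
  have face: "{(0, i)} \<in> faces (levels [])" if "i \<in> {1, 2}" for i
  proof -
    have "list_all2 (\<in>) [(0, i)] (levels [])" using that by (auto simp: levels_def segment_def)
    then show ?thesis unfolding faces_def by (metis (mono_tags, lifting) CollectI empty_set list.simps(15))
  qed
  have "?K ?o \<noteq> {}"
    by (rule separatingD[OF sep face[of 1] face[of 2]]) auto
  then have "Fin (omult ?o omega) \<le> szlenk_index TYPE('x)"
    using C o by (intro szlenk_index_ge_omult_omega[of "\<eta> / (4 * C2)"]) (auto simp: \<eta>_def)
  then show ?thesis by (simp add: omega_power_osuc)
qed

end
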